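(* Let $G$ be a simple 2-connected graph, and let $e$ and $f$ be distinct edges of $G$. If every cycle of $G$ containing both $e$ and $f$ is Hamiltonian, then $G$ is a clean ladder.
   Context: All graphs are finite. A cycle of $G$ is Hamiltonian if it contains every vertex of $G$. Let $B_3$ denote the graph consisting of two vertices joined by three edges. A 2-sum of two graphs with basepoint $p$, where $p$ is the unique common edge of the two otherwise disjoint graphs, is obtained by identifying the two copies of $p$ (with their end-vertices identified, in either of the two possible ways) and then deleting the edge $p$. A graph $L$ is a clean ladder if it can be constructed (up to isomorphism), by taking successive 2-sums, via a path decomposition whose vertices are labeled, in order, by graphs $G_0,G_1,\dots,G_n$ ($n\ge 0$) where: (i) each $G_i$ is isomorphic to $K_4$, $K_3$, or $B_3$; (ii) each edge of the path is the basepoint of the 2-sum between its endpoints (so consecutive $G_{i-1}$, $G_i$ share exactly one edge, the basepoint $p_i$; non-consecutive ones share none; and for $0<i<n$ the two basepoints of $G_i$ are distinct edges of $G_i$); (iii) neither $G_0$ nor $G_n$ is isomorphic to $B_3$; (iv) no two consecutive vertices of the path are both isomorphic to $B_3$; and (v) whenever $0<i<n$ and $G_i\cong K_4$, the two edges of $G_i$ that are basepoints of 2-sums form a matching. (When $n=0$, $L=G_0$.) *)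

theory Defs
  imports Main
begin

text \<open>
  Undirected multigraphs: \<open>ends\<close> sends an edge to its set of end-vertices, so a loop has a singleton
  as its image and parallel edges have the same image. The values of \<open>ends\<close> outside \<open>edges\<close> are
  irrelevant.
\<close>

record ('v, 'e) mgraph =
  verts :: "'v set"
  edges :: "'e set"
  ends :: "'e \<Rightarrow> 'v set"

definition fin_graph :: "('v, 'e) mgraph \<Rightarrow> bool" where
  "fin_graph G \<longleftrightarrow>
     finite (verts G) \<and> finite (edges G) \<and>
     (\<forall>e\<in>edges G. ends G e \<subseteq> verts G \<and> card (ends G e) \<in> {1, 2})"

definition simple_graph :: "('v, 'e) mgraph \<Rightarrow> bool" where
  "simple_graph G \<longleftrightarrow> (\<forall>e\<in>edges G. card (ends G e) = 2) \<and> inj_on (ends G) (edges G)"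

definition isomorphic :: "('v, 'e) mgraph \<Rightarrow> ('w, 'f) mgraph \<Rightarrow> bool" where
  "isomorphic G H \<longleftrightarrow>
     fin_graph G \<and> fin_graph H \<and>
     (\<exists>\<phi> \<psi>. bij_betw \<phi> (verts G) (verts H) \<and> bij_betw \<psi> (edges G) (edges H) \<and>
            (\<forall>e\<in>edges G. ends H (\<psi> e) = \<phi> ` ends G e))"

definition delete_verts :: "('v, 'e) mgraph \<Rightarrow> 'v set \<Rightarrow> ('v, 'e) mgraph" where
  "delete_verts G X =
     G\<lparr>verts := verts G - X, edges := {e \<in> edges G. ends G e \<inter> X = {}}\<rparr>"

definition connected_graph :: "('v, 'e) mgraph \<Rightarrow> bool" where
  "connected_graph G \<longleftrightarrow>
     verts G \<noteq> {} \<and>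
     (\<forall>u\<in>verts G. \<forall>v\<in>verts G. (u, v) \<in> {(x, y). \<exists>e\<in>edges G. ends G e = {x, y}}\<^sup>*)"

definition k_connected :: "nat \<Rightarrow> ('v, 'e) mgraph \<Rightarrow> bool" where
  "k_connected k G \<longleftrightarrow>
     k < card (verts G) \<and>
     (\<forall>X \<subseteq> verts G. card X < k \<longrightarrow> connected_graph (delete_verts G X))"

text \<open>
  A cycle is given by a cyclic enumeration of its vertices and edges. Loops and pairs of parallel
  edges count as cycles of length 1 and 2; distinctness of the edges prevents a single edge traversed
  back and forth from counting as a cycle of length 2.
\<close>

definition is_cycle :: "('v, 'e) mgraph \<Rightarrow> 'v list \<Rightarrow> 'e list \<Rightarrow> bool" where
  "is_cycle G vs es \<longleftrightarrow>
     vs \<noteq> [] \<and> length es = length vs \<and> distinct vs \<and> distinct es \<and>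
     set vs \<subseteq> verts G \<and> set es \<subseteq> edges G \<and>
     (\<forall>i<length vs. ends G (es ! i) = {vs ! i, vs ! (Suc i mod length vs)})"

definition hamiltonian_cycle :: "('v, 'e) mgraph \<Rightarrow> 'v list \<Rightarrow> 'e list \<Rightarrow> bool" where
  "hamiltonian_cycle G vs es \<longleftrightarrow> is_cycle G vs es \<and> set vs = verts G"

definition complete_graph :: "nat \<Rightarrow> (nat, nat set) mgraph" where
  "complete_graph n = \<lparr>verts = {..<n}, edges = {s. s \<subseteq> {..<n} \<and> card s = 2}, ends = (\<lambda>s. s)\<rparr>"

definition B3 :: "(nat, nat) mgraph" where
  "B3 = \<lparr>verts = {0, 1}, edges = {0, 1, 2}, ends = (\<lambda>_. {0, 1})\<rparr>"

text \<open>
  The summands of a 2-sum have disjoint vertex sets and share only the edge name \<open>p\<close>. The bijection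
  \<open>h\<close> is the chosen identification of the ends of \<open>p\<close>; the ends of \<open>p\<close> in the first summand serve as
  names of the identified vertices.
\<close>

definition two_sum ::
    "('v \<Rightarrow> 'v) \<Rightarrow> 'e \<Rightarrow> ('v, 'e) mgraph \<Rightarrow> ('v, 'e) mgraph \<Rightarrow> ('v, 'e) mgraph" where
  "two_sum h p G H =
     \<lparr>verts = verts G \<union> (verts H - ends H p),
      edges = (edges G \<union> edges H) - {p},
      ends = (\<lambda>e. if e \<in> edges G then ends G e
                  else (\<lambda>v. if v \<in> ends H p then h v else v) ` ends H e)\<rparr>"

definition is_two_sum ::
    "'e \<Rightarrow> ('v, 'e) mgraph \<Rightarrow> ('v, 'e) mgraph \<Rightarrow> ('v, 'e) mgraph \<Rightarrow> bool" where
  "is_two_sum p G H K \<longleftrightarrow>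
     verts G \<inter> verts H = {} \<and> edges G \<inter> edges H = {p} \<and>
     (\<exists>h. bij_betw h (ends H p) (ends G p) \<and> K = two_sum h p G H)"

text \<open>
  In the next two definitions \<open>Gs 0, \<dots>, Gs n\<close> are the labels along the path and \<open>p i\<close>, for
  \<open>1 \<le> i \<le> n\<close>, is the basepoint between \<open>Gs (i - 1)\<close> and \<open>Gs i\<close>.
\<close>

definition clean_ladder_labels ::
    "nat \<Rightarrow> (nat \<Rightarrow> ('v, 'e) mgraph) \<Rightarrow> (nat \<Rightarrow> 'e) \<Rightarrow> bool" where
  "clean_ladder_labels n Gs p \<longleftrightarrow>
     (\<forall>i\<le>n. isomorphic (Gs i) (complete_graph 4) \<or> isomorphic (Gs i) (complete_graph 3) \<or>
            isomorphic (Gs i) B3) \<and>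
     (\<forall>i j. i < j \<and> j \<le> n \<longrightarrow>
            verts (Gs i) \<inter> verts (Gs j) = {} \<and>
            edges (Gs i) \<inter> edges (Gs j) = (if j = Suc i then {p j} else {})) \<and>
     (\<forall>i. 0 < i \<and> i < n \<longrightarrow> p i \<noteq> p (Suc i)) \<and>
     \<not> isomorphic (Gs 0) B3 \<and> \<not> isomorphic (Gs n) B3 \<and>
     (\<forall>i<n. \<not> (isomorphic (Gs i) B3 \<and> isomorphic (Gs (Suc i)) B3)) \<and>
     (\<forall>i. 0 < i \<and> i < n \<and> isomorphic (Gs i) (complete_graph 4) \<longrightarrow>
          ends (Gs i) (p i) \<inter> ends (Gs i) (p (Suc i)) = {})"

text \<open>
  Since graphs are finite and the construction is up to isomorphism, it is no restriction to use
  natural numbers as names of the vertices and edges of the labels. \<open>Ls i\<close> is the successive 2-sum of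
  \<open>Gs 0, \<dots>, Gs i\<close>.
\<close>

definition clean_ladder :: "('v, 'e) mgraph \<Rightarrow> bool" where
  "clean_ladder L \<longleftrightarrow>
     (\<exists>n (Gs :: nat \<Rightarrow> (nat, nat) mgraph) p Ls.
        clean_ladder_labels n Gs p \<and>
        Ls 0 = Gs 0 \<and>
        (\<forall>i<n. is_two_sum (p (Suc i)) (Ls i) (Gs (Suc i)) (Ls (Suc i))) \<and>
        isomorphic L (Ls n))"

end

theory Submission
  imports Defs
begin

text \<open>
  In a 2-connected graph some cycle contains \<open>e\<close> and \<open>f\<close>. It is Hamiltonian, and deleting
  \<open>e\<close> and \<open>f\<close> from it leaves two paths \<open>a 0, \<dots>, a K\<close> and \<open>b 0, \<dots>, b L\<close> with \<open>e = {a 0, b 0}\<close> and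
  \<open>f = {a K, b L}\<close>. A chord between two vertices of the same path, or two crossing chords between the
  paths, would give a cycle through \<open>e\<close> and \<open>f\<close> that misses a vertex, unless the crossing chords are
  \<open>{a i, b (j + 1)}\<close> and \<open>{a (i + 1), b j}\<close>. Hence the part of \<open>G\<close> induced on
  \<open>a 0, \<dots>, a k, b 0, \<dots>, b l\<close>, with \<open>{a k, b l}\<close> added as a virtual edge, arises from a smaller part
  of the same kind by a 2-sum with a triangle or, at a crossing, with a \<open>K4\<close>; if the basepoint is
  itself an edge of \<open>G\<close>, a \<open>B3\<close> in between keeps a copy of it.
\<close>

subsection \<open>Labels of a clean ladder\<close>

text \<open>A simple graph is determined by the end-sets of its edges, so the construction works
  with sets of pairs and returns to edge names only inside the labels and at the very end.
  \<open>pairs W\<close> is the edge set of the complete graph on \<open>W\<close>.\<close>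

definition pairs :: "'a set \<Rightarrow> 'a set set" where
  "pairs W = {x. x \<subseteq> W \<and> card x = 2}"

lemma finite_pairs: "finite W \<Longrightarrow> finite (pairs W)"
  unfolding pairs_def by simp

lemma pairs_mono: "V \<subseteq> W \<Longrightarrow> pairs V \<subseteq> pairs W"
  unfolding pairs_def by blast

lemma pairsD:
  assumes "x \<in> pairs W"
  obtains u v where "x = {u, v}" "u \<noteq> v" "u \<in> W" "v \<in> W"
  using assms unfolding pairs_def by (auto simp: card_2_iff)

lemma bij_betw_pairs:
  assumes inj: "inj_on f W"
  shows "bij_betw ((`) f) (pairs W) (pairs (f ` W))"
proof -
  have "inj_on ((`) f) (pairs W)"
    by (rule inj_on_subset[OF inj_on_image_Pow[OF inj]]) (auto simp: pairs_def)
  moreover have "(`) f ` pairs W = pairs (f ` W)"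
  proof (intro equalityI subsetI)
    fix y assume "y \<in> (`) f ` pairs W"
    then show "y \<in> pairs (f ` W)"
      using inj unfolding pairs_def by (auto simp: card_image inj_on_subset)
  next
    fix y assume y: "y \<in> pairs (f ` W)"
    then obtain x where x: "x \<subseteq> W" "y = f ` x"
      unfolding pairs_def by (auto simp: subset_image_iff)
    then have "card x = card y"
      using inj by (simp add: card_image inj_on_subset)
    then show "y \<in> (`) f ` pairs W"
      using x y unfolding pairs_def by auto
  qed
  ultimately show ?thesis by (simp add: bij_betw_def)
qed

section \<open>Recognizing the three kinds of labels\<close>

lemma isomorphic_card_verts: "isomorphic G H \<Longrightarrow> card (verts G) = card (verts H)"
  unfolding isomorphic_def using bij_betw_same_card by blast

lemma verts_complete_graph [simp]: "verts (complete_graph n) = {..<n}"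
  by (simp add: complete_graph_def)

lemma verts_B3 [simp]: "verts B3 = {0, 1}"
  by (simp add: B3_def)

lemma fin_graph_complete: "fin_graph (complete_graph n)"
  unfolding fin_graph_def complete_graph_def by auto

lemma fin_graph_B3: "fin_graph B3"
  unfolding fin_graph_def B3_def by auto

text \<open>Any enumeration of the vertices works: edges of \<open>complete_graph\<close> are their
  own end-sets, so the edge bijection is the image map after \<open>ends H\<close>.\<close>

lemma isomorphic_complete_graphI:
  assumes fin: "finite (verts H)" and inj: "inj_on (ends H) (edges H)"
    and ends: "ends H ` edges H = pairs (verts H)"
  shows "isomorphic H (complete_graph (card (verts H)))"
proof -
  obtain \<phi> where \<phi>: "bij_betw \<phi> (verts H) {..<card (verts H)}"
    using ex_bij_betw_finite_nat[OF fin] by (auto simp: atLeast0LessThan)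
  have finE: "finite (edges H)"
    using finite_imageD[OF _ inj] ends finite_pairs[OF fin] by simp
  have E: "ends H e \<subseteq> verts H \<and> card (ends H e) = 2" if "e \<in> edges H" for e
    using that ends unfolding pairs_def by blast
  have im: "bij_betw ((`) \<phi>) (pairs (verts H)) (pairs {..<card (verts H)})"
    using bij_betw_pairs[of \<phi> "verts H"] \<phi> by (simp add: bij_betw_def)
  have "bij_betw (ends H) (edges H) (pairs (verts H))"
    using inj ends by (simp add: bij_betw_def)
  then have "bij_betw ((`) \<phi> \<circ> ends H) (edges H) (edges (complete_graph (card (verts H))))"
    using bij_betw_trans[OF _ im] by (simp add: complete_graph_def pairs_def)
  moreover have "fin_graph H"
    using fin finE E unfolding fin_graph_def by simp
  ultimately show ?thesis
    using \<phi> fin_graph_complete unfolding isomorphic_def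
    by (auto simp: complete_graph_def intro!: exI[of _ \<phi>] exI[of _ "(`) \<phi> \<circ> ends H"])
qed

lemma isomorphic_B3I:
  assumes "card (verts H) = 2" "card (edges H) = 3" "\<And>e. e \<in> edges H \<Longrightarrow> ends H e = verts H"
  shows "isomorphic H B3"
proof -
  have fin: "finite (verts H)" "finite (edges H)"
    using assms(1,2) card.infinite by fastforce+
  obtain \<phi> where \<phi>: "bij_betw \<phi> (verts H) {0, 1::nat}"
    using finite_same_card_bij[OF fin(1), of "{0, 1::nat}"] assms(1) by auto
  obtain \<psi> where \<psi>: "bij_betw \<psi> (edges H) {0, 1, 2::nat}"
    using finite_same_card_bij[OF fin(2), of "{0, 1, 2::nat}"] assms(2) by auto
  have "fin_graph H"
    using fin assms unfolding fin_graph_def by simp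
  moreover have "\<forall>e\<in>edges H. ends B3 (\<psi> e) = \<phi> ` ends H e"
    using \<phi> assms(3) by (simp add: B3_def bij_betw_def)
  moreover have "bij_betw \<phi> (verts H) (verts B3)" "bij_betw \<psi> (edges H) (edges B3)"
    using \<phi> \<psi> by (simp_all add: B3_def)
  ultimately show ?thesis
    using fin_graph_B3 unfolding isomorphic_def by blast
qed

text \<open>Supplies the next summand of a 2-sum. \<open>N\<close> holds all names in use; the only
  one reused is \<open>q\<^sub>0\<close>, the incoming basepoint. \<open>s\<^sub>0\<close> is meant
  as the outgoing basepoint, and \<open>\<beta>\<close> names the remaining edges. With
  \<open>q' = q\<close> and \<open>B = {q}\<close> all three edges are parallel, which yields
  \<open>B3\<close>.\<close>

lemma fresh_labels:
  assumes "finite (N :: nat set)" "finite W" "finite B" "q\<^sub>0 \<in> N"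
  obtains H :: "(nat, nat) mgraph" and \<alpha> \<beta> s\<^sub>0
  where "inj_on \<alpha> W" "\<alpha> ` W \<inter> N = {}" "inj_on \<beta> B" "\<beta> ` B \<inter> N = {}" "s\<^sub>0 \<notin> N" "s\<^sub>0 \<notin> \<beta> ` B"
    "verts H = \<alpha> ` W" "edges H = {q\<^sub>0, s\<^sub>0} \<union> \<beta> ` B" "ends H q\<^sub>0 = \<alpha> ` q" "ends H s\<^sub>0 = \<alpha> ` q'"
    "\<And>x. x \<in> B \<Longrightarrow> ends H (\<beta> x) = \<alpha> ` x"
proof -
  obtain m where m: "\<And>x. x \<in> N \<Longrightarrow> x < m"
    using assms(1) finite_nat_set_iff_bounded by auto
  obtain \<gamma> :: "_ \<Rightarrow> nat" where \<gamma>: "inj_on \<gamma> W"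
    using finite_imp_inj_to_nat_seg[OF assms(2)] by blast
  obtain \<delta> :: "_ \<Rightarrow> nat" where \<delta>: "inj_on \<delta> B"
    using finite_imp_inj_to_nat_seg[OF assms(3)] by blast
  \<comment> \<open>Edge names from \<open>\<beta>\<close> start at \<open>Suc m\<close>, which
    leaves \<open>m\<close> for \<open>s\<^sub>0\<close>. Vertex and edge names live in separate
    roles, so an overlap of \<open>\<alpha>\<close> and \<open>\<beta>\<close> is harmless.\<close>
  define \<alpha> where "\<alpha> x = \<gamma> x + m" for x
  define \<beta> where "\<beta> x = \<delta> x + Suc m" for x
  have inj: "inj_on \<alpha> W" "inj_on \<beta> B"
    using \<gamma> \<delta> by (auto simp: inj_on_def \<alpha>_def \<beta>_def)
  have N: "\<alpha> ` W \<inter> N = {}" "\<beta> ` B \<inter> N = {}" "m \<notin> N" "m \<notin> \<beta> ` B" "q\<^sub>0 \<noteq> m" "q\<^sub>0 \<notin> \<beta> ` B"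
    using m assms(4) by (auto simp: \<alpha>_def \<beta>_def dest!: m)
  define H :: "(nat, nat) mgraph" where "H = \<lparr>verts = \<alpha> ` W, edges = {q\<^sub>0, m} \<union> \<beta> ` B,
    ends = (\<lambda>y. if y = q\<^sub>0 then \<alpha> ` q else if y = m then \<alpha> ` q' else \<alpha> ` inv_into B \<beta> y)\<rparr>"
  have "ends H (\<beta> x) = \<alpha> ` x" if "x \<in> B" for x
    using that N inj by (auto simp: H_def)
  then have H2: "\<And>x. x \<in> B \<Longrightarrow> ends H (\<beta> x) = \<alpha> ` x" by blast
  have H1: "verts H = \<alpha> ` W" "edges H = {q\<^sub>0, m} \<union> \<beta> ` B" "ends H q\<^sub>0 = \<alpha> ` q" "ends H m = \<alpha> ` q'"
    using N by (simp_all add: H_def)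
  show ?thesis
    by (rule that[OF inj(1) N(1) inj(2) N(2-4) H1 H2])
qed

text \<open>
  A clean ladder under construction. The last label may be \<open>B3\<close>, and \<open>p (Suc n)\<close> is the edge of
  the last label reserved as the next basepoint.
\<close>

definition open_ladder ::
    "nat \<Rightarrow> (nat \<Rightarrow> (nat, nat) mgraph) \<Rightarrow> (nat \<Rightarrow> nat) \<Rightarrow> (nat \<Rightarrow> (nat, nat) mgraph) \<Rightarrow> bool" where
  "open_ladder n Gs p Ls \<longleftrightarrow>
     (\<forall>i\<le>n. isomorphic (Gs i) (complete_graph 4) \<or> isomorphic (Gs i) (complete_graph 3) \<or>
            isomorphic (Gs i) B3) \<and>
     (\<forall>i j. i < j \<and> j \<le> n \<longrightarrow>
            verts (Gs i) \<inter> verts (Gs j) = {} \<and>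
            edges (Gs i) \<inter> edges (Gs j) = (if j = Suc i then {p j} else {})) \<and>
     (\<forall>i. 0 < i \<and> i \<le> n \<longrightarrow> p i \<noteq> p (Suc i)) \<and>
     \<not> isomorphic (Gs 0) B3 \<and>
     (\<forall>i<n. \<not> (isomorphic (Gs i) B3 \<and> isomorphic (Gs (Suc i)) B3)) \<and>
     (\<forall>i. 0 < i \<and> i \<le> n \<and> isomorphic (Gs i) (complete_graph 4) \<longrightarrow>
          ends (Gs i) (p i) \<inter> ends (Gs i) (p (Suc i)) = {}) \<and>
     p (Suc n) \<in> edges (Gs n) \<and>
     Ls 0 = Gs 0 \<and>
     (\<forall>i<n. is_two_sum (p (Suc i)) (Ls i) (Gs (Suc i)) (Ls (Suc i)))"

section \<open>Extending an open ladder by one label\<close>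

lemma open_ladder_labels:
  assumes "open_ladder n Gs p Ls" "\<not> isomorphic (Gs n) B3"
  shows "clean_ladder_labels n Gs p"
  using assms unfolding open_ladder_def clean_ladder_labels_def
  by (intro conjI; (elim conjE)?; simp)

lemma open_ladder_0:
  assumes "isomorphic H (complete_graph 4) \<or> isomorphic H (complete_graph 3)" "q \<in> edges H"
  shows "open_ladder 0 (\<lambda>_. H) (\<lambda>_. q) (\<lambda>_. H)"
proof -
  have "\<not> isomorphic H B3"
    using assms(1) isomorphic_card_verts[of H B3] isomorphic_card_verts[of H "complete_graph _"]
    by force
  then show ?thesis
    using assms unfolding open_ladder_def by auto
qed

lemma open_ladder_Suc:
  assumes L: "open_ladder n Gs p Ls"
    and kind: "isomorphic H (complete_graph 4) \<or> isomorphic H (complete_graph 3) \<or> isomorphic H B3"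
    and dv: "\<And>i. i \<le> n \<Longrightarrow> verts (Gs i) \<inter> verts H = {}" "verts (Ls n) \<inter> verts H = {}"
    and de: "\<And>i. i \<le> n \<Longrightarrow> edges (Gs i) \<inter> edges H \<subseteq> {p (Suc n)}"
      "edges (Ls n) \<inter> edges H = {p (Suc n)}"
    and h: "bij_betw h (ends H (p (Suc n))) (ends (Ls n) (p (Suc n)))"
    and q: "q \<in> edges H" "q \<noteq> p (Suc n)"
      "isomorphic H (complete_graph 4) \<Longrightarrow> ends H (p (Suc n)) \<inter> ends H q = {}"
    and B3: "\<not> (isomorphic (Gs n) B3 \<and> isomorphic H B3)"
  shows "open_ladder (Suc n) (Gs(Suc n := H)) (p(Suc (Suc n) := q))
           (Ls(Suc n := two_sum h (p (Suc n)) (Ls n) H))"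
proof -
  note L' = L[unfolded open_ladder_def]
  have pH: "p (Suc n) \<in> edges H" using de(2) by blast
  have pG: "p (Suc n) \<in> edges (Gs n)" using L' by blast
  \<comment> \<open>\<open>p (Suc n)\<close> is an edge of \<open>Gs n\<close>. If it also occurred
    in an earlier label, it would have to be \<open>p n\<close>, the only edge that
    \<open>Gs n\<close> can share with one; but these two basepoints differ.\<close>
  have e1: "edges (Gs i) \<inter> edges H = (if i = n then {p (Suc n)} else {})" if "i \<le> n" for i
  proof (cases "i = n")
    case True
    then show ?thesis using de(1)[of n] pH pG by auto
  next
    case False
    then have "i < n" using that by simp
    then have "edges (Gs i) \<inter> edges (Gs n) = (if n = Suc i then {p n} else {})" and "p n \<noteq> p (Suc n)"
      using L' by auto
    then have "p (Suc n) \<notin> edges (Gs i)" using pG by (metis IntI empty_iff singletonD)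
    then show ?thesis using de(1)[OF that] False by auto
  qed
  have sum: "is_two_sum (p (Suc n)) (Ls n) H (two_sum h (p (Suc n)) (Ls n) H)"
    unfolding is_two_sum_def using dv(2) de(2) h by auto
  have L1: "\<And>i. i \<le> n \<Longrightarrow> isomorphic (Gs i) (complete_graph 4) \<or> isomorphic (Gs i) (complete_graph 3) \<or>
      isomorphic (Gs i) B3"
    and L2: "\<And>i j. i < j \<Longrightarrow> j \<le> n \<Longrightarrow> verts (Gs i) \<inter> verts (Gs j) = {} \<and>
            edges (Gs i) \<inter> edges (Gs j) = (if j = Suc i then {p j} else {})"
    and L3: "\<And>i. 0 < i \<Longrightarrow> i \<le> n \<Longrightarrow> p i \<noteq> p (Suc i)"
    and L4: "\<not> isomorphic (Gs 0) B3"
    and L5: "\<And>i. i < n \<Longrightarrow> \<not> (isomorphic (Gs i) B3 \<and> isomorphic (Gs (Suc i)) B3)"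
    and L6: "\<And>i. 0 < i \<Longrightarrow> i \<le> n \<Longrightarrow> isomorphic (Gs i) (complete_graph 4) \<Longrightarrow>
          ends (Gs i) (p i) \<inter> ends (Gs i) (p (Suc i)) = {}"
    and L8: "Ls 0 = Gs 0"
    and L9: "\<And>i. i < n \<Longrightarrow> is_two_sum (p (Suc i)) (Ls i) (Gs (Suc i)) (Ls (Suc i))"
    using L' by simp_all
  show ?thesis
    unfolding open_ladder_def
  proof (intro conjI)
    show "\<forall>i\<le>Suc n. isomorphic ((Gs(Suc n := H)) i) (complete_graph 4) \<or>
        isomorphic ((Gs(Suc n := H)) i) (complete_graph 3) \<or> isomorphic ((Gs(Suc n := H)) i) B3"
      using L1 kind by (simp add: le_Suc_eq)
    show "\<forall>i. 0 < i \<and> i \<le> Suc n \<longrightarrow> (p(Suc (Suc n) := q)) i \<noteq> (p(Suc (Suc n) := q)) (Suc i)"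
      using L3 q(2) by (auto simp: le_Suc_eq)
    show "\<not> isomorphic ((Gs(Suc n := H)) 0) B3"
      using L4 by simp
    show "\<forall>i<Suc n. \<not> (isomorphic ((Gs(Suc n := H)) i) B3 \<and> isomorphic ((Gs(Suc n := H)) (Suc i)) B3)"
      using L5 B3 by (simp add: less_Suc_eq)
    show "\<forall>i. 0 < i \<and> i \<le> Suc n \<and> isomorphic ((Gs(Suc n := H)) i) (complete_graph 4) \<longrightarrow>
        ends ((Gs(Suc n := H)) i) ((p(Suc (Suc n) := q)) i) \<inter>
        ends ((Gs(Suc n := H)) i) ((p(Suc (Suc n) := q)) (Suc i)) = {}"
      using L6 q(3) by (simp add: le_Suc_eq)
    show "(p(Suc (Suc n) := q)) (Suc (Suc n)) \<in> edges ((Gs(Suc n := H)) (Suc n))"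
      using q(1) by simp
    show "(Ls(Suc n := two_sum h (p (Suc n)) (Ls n) H)) 0 = (Gs(Suc n := H)) 0"
      using L8 by simp
    show "\<forall>i<Suc n. is_two_sum ((p(Suc (Suc n) := q)) (Suc i)) ((Ls(Suc n := two_sum h (p (Suc n)) (Ls n) H)) i)
        ((Gs(Suc n := H)) (Suc i)) ((Ls(Suc n := two_sum h (p (Suc n)) (Ls n) H)) (Suc i))"
      using L9 sum by (simp add: less_Suc_eq)
    show "\<forall>i j. i < j \<and> j \<le> Suc n \<longrightarrow>
            verts ((Gs(Suc n := H)) i) \<inter> verts ((Gs(Suc n := H)) j) = {} \<and>
            edges ((Gs(Suc n := H)) i) \<inter> edges ((Gs(Suc n := H)) j) =
              (if j = Suc i then {(p(Suc (Suc n) := q)) j} else {})"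
    proof (intro allI impI)
      fix i j assume ij: "i < j \<and> j \<le> Suc n"
      show "verts ((Gs(Suc n := H)) i) \<inter> verts ((Gs(Suc n := H)) j) = {} \<and>
            edges ((Gs(Suc n := H)) i) \<inter> edges ((Gs(Suc n := H)) j) =
              (if j = Suc i then {(p(Suc (Suc n) := q)) j} else {})"
      proof (cases "j = Suc n")
        case True
        then show ?thesis using ij dv(1)[of i] e1[of i] by auto
      next
        case False
        then have "i < j \<and> j \<le> n" using ij by simp
        then have "verts (Gs i) \<inter> verts (Gs j) = {} \<and>
            edges (Gs i) \<inter> edges (Gs j) = (if j = Suc i then {p j} else {})"
          using L2 by blast
        then show ?thesis using \<open>i < j \<and> j \<le> n\<close> by simp
      qed
    qed
  qed
qed

text \<open>Bounds the names in use, so that fresh ones exist for the next label. A 2-sum introduces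
  no names beyond those of its summands.\<close>

lemma open_ladder_finite:
  assumes "open_ladder n Gs p Ls"
  shows "finite (\<Union>i\<le>n. verts (Gs i) \<union> edges (Gs i))"
    and "verts (Ls n) \<union> edges (Ls n) \<subseteq> (\<Union>i\<le>n. verts (Gs i) \<union> edges (Gs i))"
proof -
  note L = assms[unfolded open_ladder_def]
  have "isomorphic (Gs i) (complete_graph 4) \<or> isomorphic (Gs i) (complete_graph 3) \<or>
      isomorphic (Gs i) B3" if "i \<le> n" for i
    using L that by simp
  then have "fin_graph (Gs i)" if "i \<le> n" for i
    using that unfolding isomorphic_def by blast
  then show "finite (\<Union>i\<le>n. verts (Gs i) \<union> edges (Gs i))"
    unfolding fin_graph_def by simp
  have "verts (Ls m) \<union> edges (Ls m) \<subseteq> (\<Union>i\<le>m. verts (Gs i) \<union> edges (Gs i))" if "m \<le> n" for m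
    using that
  proof (induction m)
    case 0
    then show ?case using L by simp
  next
    case (Suc m)
    then have "is_two_sum (p (Suc m)) (Ls m) (Gs (Suc m)) (Ls (Suc m))"
      using L by simp
    then have "verts (Ls (Suc m)) \<union> edges (Ls (Suc m)) \<subseteq>
        (verts (Ls m) \<union> edges (Ls m)) \<union> (verts (Gs (Suc m)) \<union> edges (Gs (Suc m)))"
      unfolding is_two_sum_def two_sum_def by auto
    moreover have "verts (Ls m) \<union> edges (Ls m) \<subseteq> (\<Union>i\<le>m. verts (Gs i) \<union> edges (Gs i))"
      using Suc by simp
    ultimately show ?case unfolding atMost_Suc by blast
  qed
  then show "verts (Ls n) \<union> edges (Ls n) \<subseteq> (\<Union>i\<le>n. verts (Gs i) \<union> edges (Gs i))" by blast
qed

text \<open>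
  Vertex set \<open>V\<close>, edges \<open>A\<close> besides the open basepoint, which joins the two elements of \<open>q\<close>; \<open>A\<close>
  may contain an edge parallel to the basepoint. The last label is allowed to be \<open>B3\<close> only if \<open>t\<close>.
\<close>

definition ladder_model :: "'v set \<Rightarrow> 'v set set \<Rightarrow> 'v set \<Rightarrow> bool \<Rightarrow> bool" where
  "ladder_model V A q t \<longleftrightarrow> finite V \<and> q \<in> pairs V \<and> A \<subseteq> pairs V \<and>
     (\<exists>n Gs p Ls \<phi> \<psi>. open_ladder n Gs p Ls \<and> (isomorphic (Gs n) B3 \<longrightarrow> t) \<and>
        bij_betw \<phi> V (verts (Ls n)) \<and> bij_betw \<psi> A (edges (Ls n) - {p (Suc n)}) \<and>
        p (Suc n) \<in> edges (Ls n) \<and> ends (Ls n) (p (Suc n)) = \<phi> ` q \<and>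
        (\<forall>x\<in>A. ends (Ls n) (\<psi> x) = \<phi> ` x))"

text \<open>When the construction stops, the reserved basepoint is never deleted and becomes an
  ordinary edge of the ladder, here the image of the edge \<open>q\<close> of \<open>G\<close>.
  Finiteness of the sum is transported back along the bijections.\<close>

lemma clean_ladder_if_ladder_model:
  assumes M: "ladder_model (verts G) A q False" and "q \<notin> A"
    and G: "fin_graph G" "inj_on (ends G) (edges G)" "ends G ` edges G = insert q A"
  shows "clean_ladder G"
proof -
  from M obtain n Gs p Ls \<phi> \<psi> where L: "open_ladder n Gs p Ls" "\<not> isomorphic (Gs n) B3"
    and \<phi>: "bij_betw \<phi> (verts G) (verts (Ls n))" and \<psi>: "bij_betw \<psi> A (edges (Ls n) - {p (Suc n)})"
    and p: "p (Suc n) \<in> edges (Ls n)" "ends (Ls n) (p (Suc n)) = \<phi> ` q"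
    and ends: "\<forall>x\<in>A. ends (Ls n) (\<psi> x) = \<phi> ` x"
    and q: "q \<in> pairs (verts G)" "A \<subseteq> pairs (verts G)"
    unfolding ladder_model_def by auto
  define \<psi>' where "\<psi>' = \<psi>(q := p (Suc n))"
  have "bij_betw \<psi>' (insert q A) (edges (Ls n))"
    using \<psi> p(1) \<open>q \<notin> A\<close> unfolding bij_betw_def \<psi>'_def inj_on_def by auto
  moreover have "bij_betw (ends G) (edges G) (insert q A)"
    using G by (simp add: bij_betw_def)
  ultimately have bij: "bij_betw (\<psi>' \<circ> ends G) (edges G) (edges (Ls n))"
    using bij_betw_trans by blast
  have e': "ends (Ls n) (\<psi>' x) = \<phi> ` x" if "x \<in> insert q A" for x
    using that p(2) ends \<open>q \<notin> A\<close> unfolding \<psi>'_def by auto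
  have eG: "ends (Ls n) ((\<psi>' \<circ> ends G) e) = \<phi> ` ends G e" if "e \<in> edges G" for e
  proof -
    have "ends G e \<in> insert q A" using that unfolding G(3)[symmetric] by (rule imageI)
    then show ?thesis using e' by simp
  qed
  have "fin_graph (Ls n)"
    unfolding fin_graph_def
  proof (intro conjI ballI)
    show "finite (verts (Ls n))" "finite (edges (Ls n))"
      using G(1) bij_betw_finite[OF \<phi>] bij_betw_finite[OF bij] unfolding fin_graph_def by blast+
  next
    fix y assume "y \<in> edges (Ls n)"
    then obtain e where e: "e \<in> edges G" "y = (\<psi>' \<circ> ends G) e"
      using bij unfolding bij_betw_def by blast
    then have y: "ends (Ls n) y = \<phi> ` ends G e" using eG by simp
    have "ends G e \<subseteq> verts G" "card (ends G e) \<in> {1, 2}"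
      using e(1) G(1) unfolding fin_graph_def by auto
    then show "ends (Ls n) y \<subseteq> verts (Ls n)" "card (ends (Ls n) y) \<in> {1, 2}"
      using \<phi> unfolding y bij_betw_def by (auto simp: card_image inj_on_subset)
  qed
  then have "isomorphic G (Ls n)"
    using G(1) \<phi> bij eG unfolding isomorphic_def by blast
  moreover have "Ls 0 = Gs 0" "\<forall>i<n. is_two_sum (p (Suc i)) (Ls i) (Gs (Suc i)) (Ls (Suc i))"
    using L(1) by (simp_all add: open_ladder_def)
  ultimately show ?thesis
    using open_ladder_labels[OF L] unfolding clean_ladder_def by blast
qed

section \<open>Models consisting of one label, and attaching a further label\<close>

lemma isomorphic_complete_graph_relabel:
  assumes fin: "finite W" and inj: "inj_on \<alpha> W" and V: "verts H = \<alpha> ` W"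
    and bij: "bij_betw \<psi> (pairs W) (edges H)" and ends: "\<And>x. x \<in> pairs W \<Longrightarrow> ends H (\<psi> x) = \<alpha> ` x"
  shows "isomorphic H (complete_graph (card W))"
proof -
  have im: "edges H = \<psi> ` pairs W" using bij by (simp add: bij_betw_def)
  have "ends H ` edges H = (`) \<alpha> ` pairs W"
    unfolding im image_image using ends by simp
  then have e: "ends H ` edges H = pairs (verts H)"
    using bij_betw_pairs[OF inj] V by (simp add: bij_betw_def)
  have "inj_on (ends H \<circ> \<psi>) (pairs W)"
    using bij_betw_pairs[OF inj] ends by (auto simp: bij_betw_def cong: inj_on_cong)
  then have "inj_on (ends H) (edges H)"
    unfolding im by (rule inj_on_imageI)
  then have "isomorphic H (complete_graph (card (verts H)))"
    using e fin V by (intro isomorphic_complete_graphI) simp_all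
  then show ?thesis using V inj by (simp add: card_image)
qed

lemma bij_betw_two_marked:
  assumes "inj_on \<beta> (P - {q, q'})" "q \<in> P" "q' \<in> P" "q \<noteq> q'" "q\<^sub>0 \<noteq> s\<^sub>0"
    "q\<^sub>0 \<notin> \<beta> ` (P - {q, q'})" "s\<^sub>0 \<notin> \<beta> ` (P - {q, q'})"
  shows "bij_betw (\<beta>(q := q\<^sub>0, q' := s\<^sub>0)) P ({q\<^sub>0, s\<^sub>0} \<union> \<beta> ` (P - {q, q'}))"
proof -
  let ?f = "\<beta>(q := q\<^sub>0, q' := s\<^sub>0)"
  have 1: "bij_betw ?f (P - {q, q'}) (\<beta> ` (P - {q, q'}))"
    using inj_on_imp_bij_betw[OF assms(1)] by (rule bij_betw_cong[THEN iffD1, rotated]) auto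
  have 2: "bij_betw ?f {q, q'} {q\<^sub>0, s\<^sub>0}"
    using assms(4,5) by (auto simp: bij_betw_def)
  have "bij_betw ?f ({q, q'} \<union> (P - {q, q'})) ({q\<^sub>0, s\<^sub>0} \<union> \<beta> ` (P - {q, q'}))"
    using assms(6,7) by (intro bij_betw_combine[OF 2 1]) auto
  moreover have "{q, q'} \<union> (P - {q, q'}) = P" using assms(2,3) by auto
  ultimately show ?thesis by simp
qed

lemma bij_betw_remove:
  assumes "bij_betw f P Q" "a \<in> P"
  shows "bij_betw f (P - {a}) (Q - {f a})"
  using assms unfolding bij_betw_def inj_on_def by blast

lemma ladder_model_base:
  assumes W: "card W = 3 \<or> card W = 4" and q: "q \<in> pairs W"
  shows "ladder_model W (pairs W - {q}) q False"
proof -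
  have fin: "finite W"
    using W card.infinite by fastforce
  \<comment> \<open>A first label has no incoming basepoint. The name \<open>0\<close> stands for
    its reserved edge \<open>q\<close>, and any second pair \<open>q'\<close> can fill the other
    marked place of \<open>fresh_labels\<close>, where it is an ordinary edge.\<close>
  obtain q' where q': "q' \<in> pairs W" "q \<noteq> q'"
  proof -
    obtain u v where uv: "q = {u, v}" "u \<noteq> v" "u \<in> W" "v \<in> W" using q by (rule pairsD)
    have "\<not> W \<subseteq> {u, v}" using W card_mono[of "{u, v}" W] uv(2) by auto
    then obtain w where "w \<in> W" "w \<notin> {u, v}" by blast
    then have "{u, w} \<in> pairs W" "q \<noteq> {u, w}"
      using uv unfolding pairs_def by (auto simp: doubleton_eq_iff)
    then show ?thesis by (rule that)
  qed
  define B where "B = pairs W - {q, q'}"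
  have finB: "finite B" unfolding B_def using finite_pairs[OF fin] by simp
  obtain H :: "(nat, nat) mgraph" and \<alpha> \<beta> s\<^sub>0
    where H: "inj_on \<alpha> W" "\<alpha> ` W \<inter> {0} = {}" "inj_on \<beta> B" "\<beta> ` B \<inter> {0} = {}" "s\<^sub>0 \<notin> {0}" "s\<^sub>0 \<notin> \<beta> ` B"
    "verts H = \<alpha> ` W" "edges H = {0, s\<^sub>0} \<union> \<beta> ` B" "ends H 0 = \<alpha> ` q" "ends H s\<^sub>0 = \<alpha> ` q'"
    "\<And>x. x \<in> B \<Longrightarrow> ends H (\<beta> x) = \<alpha> ` x"
    using fresh_labels[of "{0}" W B 0 q q'] fin finB by (metis finite.intros singletonI)
  let ?\<psi> = "\<beta>(q := 0, q' := s\<^sub>0)"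
  have bij: "bij_betw ?\<psi> (pairs W) (edges H)"
    unfolding H(8) B_def using H(3,4,5,6) q q'
    by (intro bij_betw_two_marked) (auto simp: B_def)
  have ends: "ends H (?\<psi> x) = \<alpha> ` x" if "x \<in> pairs W" for x
    using that H(9,10,11) by (simp add: B_def)
  have "isomorphic H (complete_graph (card W))"
    using fin H(1,7) bij ends by (rule isomorphic_complete_graph_relabel)
  then have L: "open_ladder 0 (\<lambda>_. H) (\<lambda>_. 0) (\<lambda>_. H)"
    using W H(8) by (intro open_ladder_0) auto
  have notB3: "\<not> isomorphic H B3"
    using isomorphic_card_verts[of H B3] W H(1,7) by (auto simp: card_image)
  have q0: "?\<psi> q = 0" using q'(2) by simp
  have "bij_betw ?\<psi> (pairs W - {q}) (edges H - {0})"
    using bij_betw_remove[OF bij q] unfolding q0 .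
  then show ?thesis
    unfolding ladder_model_def using fin q L notB3 inj_on_imp_bij_betw[OF H(1)] H(7,8,9) ends
    by (intro conjI exI[of _ 0] exI[of _ "\<lambda>_. H"] exI[of _ "\<lambda>_. 0"] exI[of _ \<alpha>] exI[of _ ?\<psi>])
      simp_all
qed

text \<open>One 2-sum along \<open>q\<close>. Either the new label is a complete graph on
  \<open>W\<close>, whose pairs other than the two basepoints become new edges, or it is a
  \<open>B3\<close> on \<open>q\<close>, whose two basepoints and third edge are parallel; that
  third edge is the surviving copy of \<open>q\<close>. The flag \<open>t\<close> prevents two
  consecutive \<open>B3\<close> labels.\<close>

lemma ladder_model_attach:
  assumes M: "ladder_model V A q t" and fin: "finite W" and VW: "V \<inter> W = q"
    and q': "q' \<in> pairs W" and B: "B \<subseteq> pairs W" and AB: "A \<inter> B = {}"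
    and kind: "(card W = 3 \<or> card W = 4 \<and> q \<inter> q' = {}) \<and> q' \<noteq> q \<and> B = pairs W - {q, q'} \<or>
      W = q \<and> q' = q \<and> B = {q} \<and> \<not> t"
  shows "ladder_model (V \<union> W) (A \<union> B) q' (W = q)"
proof -
  from M obtain n Gs p Ls \<phi> \<psi> where L: "open_ladder n Gs p Ls" and t: "isomorphic (Gs n) B3 \<longrightarrow> t"
    and \<phi>: "bij_betw \<phi> V (verts (Ls n))" and \<psi>: "bij_betw \<psi> A (edges (Ls n) - {p (Suc n)})"
    and p: "p (Suc n) \<in> edges (Ls n)" "ends (Ls n) (p (Suc n)) = \<phi> ` q"
    and ends: "\<forall>x\<in>A. ends (Ls n) (\<psi> x) = \<phi> ` x"
    and V: "finite V" "q \<in> pairs V" "A \<subseteq> pairs V"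
    unfolding ladder_model_def by auto
  define N where "N = (\<Union>i\<le>n. verts (Gs i) \<union> edges (Gs i))"
  define q\<^sub>0 where "q\<^sub>0 = p (Suc n)"
  have N: "finite N" "verts (Ls n) \<subseteq> N" "edges (Ls n) \<subseteq> N"
    using open_ladder_finite[OF L] unfolding N_def by auto
  have NG: "verts (Gs i) \<subseteq> N" "edges (Gs i) \<subseteq> N" if "i \<le> n" for i
    using that unfolding N_def by auto
  have q0N: "q\<^sub>0 \<in> N" using p(1) N(3) unfolding q\<^sub>0_def by blast
  have finB: "finite B" using finite_subset[OF B finite_pairs[OF fin]] .
  have qW: "q \<subseteq> W" "card q = 2" "q \<subseteq> V" using V(2) VW by (auto simp: pairs_def)
  then have qp: "q \<in> pairs W" by (simp add: pairs_def)
  have q'W: "q' \<subseteq> W" using q' by (simp add: pairs_def)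
  obtain H :: "(nat, nat) mgraph" and \<alpha> \<beta> s\<^sub>0
    where \<alpha>: "inj_on \<alpha> W" "\<alpha> ` W \<inter> N = {}" and \<beta>: "inj_on \<beta> B" "\<beta> ` B \<inter> N = {}"
      and s0: "s\<^sub>0 \<notin> N" "s\<^sub>0 \<notin> \<beta> ` B"
      and H: "verts H = \<alpha> ` W" "edges H = {q\<^sub>0, s\<^sub>0} \<union> \<beta> ` B" "ends H q\<^sub>0 = \<alpha> ` q" "ends H s\<^sub>0 = \<alpha> ` q'"
        "\<And>x. x \<in> B \<Longrightarrow> ends H (\<beta> x) = \<alpha> ` x"
    using fresh_labels[OF N(1) fin finB q0N] by metis
  have q0: "q\<^sub>0 \<notin> \<beta> ` B" "q\<^sub>0 \<noteq> s\<^sub>0" using \<beta>(2) s0(1) q0N by auto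
  have cardH: "card (verts H) = card W" using H(1) \<alpha>(1) by (simp add: card_image)
  have kindH: "isomorphic H (complete_graph 4) \<or> isomorphic H (complete_graph 3) \<or> isomorphic H B3"
    using kind
  proof (elim disjE)
    assume *: "(card W = 3 \<or> card W = 4 \<and> q \<inter> q' = {}) \<and> q' \<noteq> q \<and> B = pairs W - {q, q'}"
    let ?\<psi> = "\<beta>(q := q\<^sub>0, q' := s\<^sub>0)"
    have "bij_betw ?\<psi> (pairs W) (edges H)"
      using bij_betw_two_marked[of \<beta> "pairs W" q q' q\<^sub>0 s\<^sub>0] \<beta>(1) qp q' * q0 s0 H(2) by auto
    moreover have "ends H (?\<psi> x) = \<alpha> ` x" if "x \<in> pairs W" for x
      using that H(3,4,5) * by simp
    ultimately have "isomorphic H (complete_graph (card W))"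
      using fin \<alpha>(1) H(1) by (intro isomorphic_complete_graph_relabel)
    then show ?thesis using * by auto
  next
    assume *: "W = q \<and> q' = q \<and> B = {q} \<and> \<not> t"
    have "card (edges H) = 3" using H(2) * q0 s0 by simp
    moreover have "ends H e = verts H" if "e \<in> edges H" for e using that H * by auto
    ultimately show ?thesis using cardH qW(2) * by (intro disjI2 isomorphic_B3I) auto
  qed
  have K4: "q \<inter> q' = {}" if "isomorphic H (complete_graph 4)"
    using isomorphic_card_verts[OF that] cardH kind qW(2) by auto
  have B3: "W = q \<and> \<not> t" if "isomorphic H B3"
    using isomorphic_card_verts[OF that] cardH kind by auto
  \<comment> \<open>The identification sends the new copy of a vertex of \<open>q\<close> to its
    name in the old sum. Since a 2-sum keeps the names of the first summand, \<open>\<phi>'\<close>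
    uses \<open>\<phi>\<close> on all of \<open>V\<close> and \<open>\<alpha>\<close> only on
    \<open>W - q\<close>.\<close>
  define h where "h = \<phi> \<circ> inv_into W \<alpha>"
  have h: "h (\<alpha> x) = \<phi> x" if "x \<in> W" for x
    using that \<alpha>(1) by (simp add: h_def)
  have "inj_on \<phi> q" using \<phi> qW(3) inj_on_subset unfolding bij_betw_def by blast
  then have hbij: "bij_betw h (\<alpha> ` q) (\<phi> ` q)"
    using h qW(1) unfolding bij_betw_def inj_on_def by (auto simp: image_iff subset_iff)
  define K where "K = two_sum h q\<^sub>0 (Ls n) H"
  have L': "open_ladder (Suc n) (Gs(Suc n := H)) (p(Suc (Suc n) := s\<^sub>0)) (Ls(Suc n := K))"
    unfolding K_def
  proof (rule open_ladder_Suc[OF L kindH, folded q\<^sub>0_def])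
    show "verts (Gs i) \<inter> verts H = {}" if "i \<le> n" for i
      using NG(1)[OF that] H(1) \<alpha>(2) by blast
    show "verts (Ls n) \<inter> verts H = {}"
      using N(2) H(1) \<alpha>(2) by blast
    show "edges (Gs i) \<inter> edges H \<subseteq> {q\<^sub>0}" if "i \<le> n" for i
      using NG(2)[OF that] H(2) \<beta>(2) s0(1) by blast
    show "edges (Ls n) \<inter> edges H = {q\<^sub>0}"
      using N(3) H(2) \<beta>(2) s0(1) p(1) unfolding q\<^sub>0_def by blast
    show "bij_betw h (ends H q\<^sub>0) (ends (Ls n) q\<^sub>0)"
      using hbij H(3) p(2) unfolding q\<^sub>0_def by simp
    show "s\<^sub>0 \<in> edges H" "s\<^sub>0 \<noteq> q\<^sub>0" using H(2) q0 by auto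
    show "ends H q\<^sub>0 \<inter> ends H s\<^sub>0 = {}" if "isomorphic H (complete_graph 4)"
      using K4[OF that] H(3,4) inj_on_image_Int[OF \<alpha>(1) qW(1) q'W] by simp
    show "\<not> (isomorphic (Gs n) B3 \<and> isomorphic H B3)"
      using B3 t by blast
  qed
  define \<phi>' where "\<phi>' x = (if x \<in> V then \<phi> x else \<alpha> x)" for x
  define \<psi>' where "\<psi>' x = (if x \<in> A then \<psi> x else \<beta> x)" for x
  have vK: "verts K = verts (Ls n) \<union> (\<alpha> ` W - \<alpha> ` q)" "edges K = edges (Ls n) \<union> edges H - {q\<^sub>0}"
    unfolding K_def two_sum_def using H(1,3) by simp_all
  have eK1: "ends K y = ends (Ls n) y" if "y \<in> edges (Ls n)" for y
    using that unfolding K_def two_sum_def by simp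
  have eK2: "ends K y = \<phi>' ` x" if "y \<notin> edges (Ls n)" "ends H y = \<alpha> ` x" "x \<subseteq> W" for x y
  proof -
    have "(if \<alpha> z \<in> \<alpha> ` q then h (\<alpha> z) else \<alpha> z) = \<phi>' z" if "z \<in> W" for z
    proof -
      have "\<alpha> z \<in> \<alpha> ` q \<longleftrightarrow> z \<in> V"
        using inj_on_image_mem_iff[OF \<alpha>(1) that qW(1)] VW that by blast
      then show ?thesis using h[OF that] by (simp add: \<phi>'_def)
    qed
    then have "(\<lambda>v. if v \<in> \<alpha> ` q then h v else v) ` \<alpha> ` x = \<phi>' ` x"
      unfolding image_image using that(3) by (intro image_cong refl) blast
    then show ?thesis
      unfolding K_def two_sum_def using that(1,2) H(3) by simp
  qed
  have b1: "bij_betw \<phi>' (V \<union> W) (verts K)"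
  proof -
    have "bij_betw \<phi>' V (verts (Ls n))"
      using \<phi> by (rule bij_betw_cong[THEN iffD1, rotated]) (simp add: \<phi>'_def)
    moreover have "bij_betw \<phi>' (W - q) (\<alpha> ` (W - q))"
      using inj_on_imp_bij_betw[OF inj_on_subset[OF \<alpha>(1)], of "W - q"]
      by (rule bij_betw_cong[THEN iffD1, rotated]) (use VW in \<open>auto simp: \<phi>'_def\<close>)
    moreover have "\<alpha> ` (W - q) = \<alpha> ` W - \<alpha> ` q"
      using inj_on_image_set_diff[OF \<alpha>(1), of W q] qW(1) by blast
    moreover have "verts (Ls n) \<inter> (\<alpha> ` W - \<alpha> ` q) = {}" using N(2) \<alpha>(2) by blast
    ultimately have "bij_betw \<phi>' (V \<union> (W - q)) (verts K)"
      unfolding vK(1) by (metis bij_betw_combine)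
    moreover have "V \<union> (W - q) = V \<union> W" using qW(3) by blast
    ultimately show ?thesis by simp
  qed
  have b2: "bij_betw \<psi>' (A \<union> B) (edges K - {s\<^sub>0})"
  proof -
    have "bij_betw \<psi>' A (edges (Ls n) - {q\<^sub>0})"
      using \<psi> unfolding q\<^sub>0_def by (rule bij_betw_cong[THEN iffD1, rotated]) (simp add: \<psi>'_def)
    moreover have "bij_betw \<psi>' B (\<beta> ` B)"
      using inj_on_imp_bij_betw[OF \<beta>(1)]
      by (rule bij_betw_cong[THEN iffD1, rotated]) (use AB in \<open>auto simp: \<psi>'_def\<close>)
    moreover have "(edges (Ls n) - {q\<^sub>0}) \<inter> \<beta> ` B = {}" using N(3) \<beta>(2) by blast
    ultimately have "bij_betw \<psi>' (A \<union> B) ((edges (Ls n) - {q\<^sub>0}) \<union> \<beta> ` B)"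
      by (rule bij_betw_combine)
    moreover have "(edges (Ls n) - {q\<^sub>0}) \<union> \<beta> ` B = edges K - {s\<^sub>0}"
      unfolding vK(2) H(2) using s0 q0 N(3) by blast
    ultimately show ?thesis by simp
  qed
  have pV: "q' \<in> pairs (V \<union> W)" "A \<union> B \<subseteq> pairs (V \<union> W)"
    using V(3) q' B pairs_mono[of V "V \<union> W"] pairs_mono[of W "V \<union> W"] by blast+
  have sK: "ends K s\<^sub>0 = \<phi>' ` q'" "s\<^sub>0 \<in> edges K"
    using eK2[OF _ H(4) q'W] s0(1) N(3) vK(2) H(2) q0 by auto
  have eK: "ends K (\<psi>' x) = \<phi>' ` x" if "x \<in> A \<union> B" for x
  proof (cases "x \<in> A")
    case True
    then have "\<psi> x \<in> edges (Ls n)" using \<psi> unfolding bij_betw_def by blast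
    moreover have "x \<subseteq> V" using True V(3) by (auto simp: pairs_def)
    ultimately show ?thesis
      using True eK1 ends by (auto simp: \<psi>'_def \<phi>'_def intro!: image_cong)
  next
    case False
    then have x: "x \<in> B" using that by simp
    moreover have "x \<subseteq> W" using x B by (auto simp: pairs_def)
    ultimately have "ends K (\<beta> x) = \<phi>' ` x"
      using eK2[OF _ H(5)] \<beta>(2) N(3) by blast
    then show ?thesis using False by (simp add: \<psi>'_def)
  qed
  show ?thesis
    unfolding ladder_model_def
  proof (intro conjI exI)
    show "open_ladder (Suc n) (Gs(Suc n := H)) (p(Suc (Suc n) := s\<^sub>0)) (Ls(Suc n := K))"
      by (rule L')
    show "isomorphic ((Gs(Suc n := H)) (Suc n)) B3 \<longrightarrow> W = q"
      using B3 by simp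
    show "bij_betw \<phi>' (V \<union> W) (verts ((Ls(Suc n := K)) (Suc n)))"
      using b1 by simp
    show "bij_betw \<psi>' (A \<union> B) (edges ((Ls(Suc n := K)) (Suc n)) - {(p(Suc (Suc n) := s\<^sub>0)) (Suc (Suc n))})"
      using b2 by simp
    show "(p(Suc (Suc n) := s\<^sub>0)) (Suc (Suc n)) \<in> edges ((Ls(Suc n := K)) (Suc n))"
      "ends ((Ls(Suc n := K)) (Suc n)) ((p(Suc (Suc n) := s\<^sub>0)) (Suc (Suc n))) = \<phi>' ` q'"
      using sK by simp_all
    show "\<forall>x\<in>A \<union> B. ends ((Ls(Suc n := K)) (Suc n)) (\<psi>' x) = \<phi>' ` x"
      using eK by simp
  qed (use fin V(1) pV in simp_all)
qed

lemma ladder_model_start: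
  assumes "card W = 3 \<or> card W = 4" "q \<in> pairs W" "pairs W - {q} \<subseteq> E"
  shows "ladder_model W (E \<inter> pairs W - {q}) q False"
proof -
  have "E \<inter> pairs W - {q} = pairs W - {q}" using assms(3) by blast
  then show ?thesis using ladder_model_base[OF assms(1,2)] by simp
qed

text \<open>The hypothesis \<open>EW\<close> says that no edge joins \<open>V - q\<close> to
  \<open>W - q\<close>, so \<open>q\<close> separates the new vertices from the old ones and the
  enlarged induced part is a 2-sum along \<open>q\<close>.\<close>

lemma ladder_model_extend:
  assumes M: "ladder_model V (E \<inter> pairs V - {q}) q False"
    and W: "card W = 3 \<or> card W = 4 \<and> q \<inter> q' = {}" and VW: "V \<inter> W = q"
    and q': "q' \<in> pairs W" "q' \<noteq> q"
    and WE: "pairs W - {q, q'} \<subseteq> E"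
    and EW: "E \<inter> pairs (V \<union> W) \<subseteq> pairs V \<union> pairs W"
  shows "ladder_model (V \<union> W) (E \<inter> pairs (V \<union> W) - {q'}) q' False"
proof -
  have fin: "finite W" using W card.infinite by fastforce
  have q: "q \<in> pairs V" "q \<subseteq> W" "card q = 2" "finite q"
    using M VW fin by (auto simp: ladder_model_def pairs_def)
  then have qq: "q \<in> pairs q" and qV: "V \<union> q = V" "V \<inter> q = q" by (auto simp: pairs_def)
  have VWq: "x = q" if "x \<in> pairs V" "x \<in> pairs W" for x
    using that VW q(3,4) card_subset_eq[of q x] by (auto simp: pairs_def)
  \<comment> \<open>The 2-sum deletes the basepoint. If \<open>q\<close> is an edge, a
    \<open>B3\<close> is inserted first to keep a copy, and \<open>t\<close> records this; the label
    on \<open>W\<close> that follows is not a \<open>B3\<close>, so either value of \<open>t\<close>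
    is acceptable.\<close>
  obtain t where M': "ladder_model V (E \<inter> pairs V) q t"
  proof (cases "q \<in> E")
    case True
    then have "(E \<inter> pairs V - {q}) \<union> {q} = E \<inter> pairs V" using q(1) by blast
    then have "ladder_model V (E \<inter> pairs V) q True"
      using ladder_model_attach[OF M q(4) qV(2) qq, of "{q}"] qq qV(1) by simp
    then show ?thesis by (rule that)
  next
    case False
    then have "E \<inter> pairs V - {q} = E \<inter> pairs V" by blast
    then show ?thesis using that M by simp
  qed
  have "ladder_model (V \<union> W) (E \<inter> pairs V \<union> (pairs W - {q, q'})) q' (W = q)"
    by (rule ladder_model_attach[OF M' fin VW q'(1)]) (use VWq W q'(2) in auto)
  moreover have "W \<noteq> q" using W q(3) by auto
  moreover have "E \<inter> pairs V \<union> (pairs W - {q, q'}) = E \<inter> pairs (V \<union> W) - {q'}"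
  proof (intro equalityI subsetI)
    fix x assume x: "x \<in> E \<inter> pairs V \<union> (pairs W - {q, q'})"
    then have "x \<in> E" "x \<in> pairs (V \<union> W)" using WE by (auto simp: pairs_def)
    moreover have "x \<noteq> q'" using x VWq q' by blast
    ultimately show "x \<in> E \<inter> pairs (V \<union> W) - {q'}" by blast
  next
    fix x assume "x \<in> E \<inter> pairs (V \<union> W) - {q'}"
    then show "x \<in> E \<inter> pairs V \<union> (pairs W - {q, q'})" using EW q(1) by blast
  qed
  ultimately show ?thesis by simp
qed

subsection \<open>Two paths with rungs\<close>

text \<open>
  \<open>a 0, \<dots>, a K\<close> and \<open>b 0, \<dots>, b L\<close> are the two paths that remain of a Hamiltonian cycle after the
  deletion of \<open>e = {a 0, b 0}\<close> and \<open>f = {a K, b L}\<close>.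
\<close>

locale ladder =
  fixes E :: "'v set set" and a b :: "nat \<Rightarrow> 'v" and K L :: nat
  assumes inj_a: "inj_on a {..K}" and inj_b: "inj_on b {..L}"
    and disj: "a ` {..K} \<inter> b ` {..L} = {}"
    and rail_a: "i < K \<Longrightarrow> {a i, a (Suc i)} \<in> E"
    and rail_b: "i < L \<Longrightarrow> {b i, b (Suc i)} \<in> E"
    and first_rung: "{a 0, b 0} \<in> E"
    and chord_a: "i < j \<Longrightarrow> j \<le> K \<Longrightarrow> {a i, a j} \<in> E \<Longrightarrow> j = Suc i"
    and chord_b: "i < j \<Longrightarrow> j \<le> L \<Longrightarrow> {b i, b j} \<in> E \<Longrightarrow> j = Suc i"
    and cross: "i < i' \<Longrightarrow> i' \<le> K \<Longrightarrow> j < j' \<Longrightarrow> j' \<le> L \<Longrightarrow> {a i, b j'} \<in> E \<Longrightarrow> {a i', b j} \<in> E \<Longrightarrow>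
      i' = Suc i \<and> j' = Suc j"
begin

text \<open>The two rails play symmetric roles, so facts about the last vertex of \<open>a\<close>
  carry over to \<open>b\<close>.\<close>

lemma swap: "ladder E b a L K"
proof
  show "i' = Suc i \<and> j' = Suc j"
    if "i < i'" "i' \<le> L" "j < j'" "j' \<le> K" "{b i, a j'} \<in> E" "{b i', a j} \<in> E" for i i' j j'
    using cross[of j j' i i'] that by (simp add: insert_commute)
qed (use inj_a inj_b disj rail_a rail_b first_rung chord_a chord_b in \<open>auto simp: insert_commute\<close>)

definition vs :: "nat \<Rightarrow> nat \<Rightarrow> 'v set" where
  "vs k l = a ` {..k} \<union> b ` {..l}"

lemma a_eq: "i \<le> K \<Longrightarrow> j \<le> K \<Longrightarrow> a i = a j \<longleftrightarrow> i = j"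
  using inj_a by (auto simp: inj_on_def)

lemma b_eq: "i \<le> L \<Longrightarrow> j \<le> L \<Longrightarrow> b i = b j \<longleftrightarrow> i = j"
  using inj_b by (auto simp: inj_on_def)

lemma a_neq_b: "i \<le> K \<Longrightarrow> j \<le> L \<Longrightarrow> a i \<noteq> b j"
  using disj by blast

text \<open>The rail \<open>a\<close> has no chords, so the only earlier vertex of \<open>a\<close>
  adjacent to \<open>a (Suc k)\<close> is \<open>a k\<close>.\<close>

lemma new_a_edge:
  assumes x: "x \<in> E" "x \<in> pairs (vs (Suc k) l)" "a (Suc k) \<in> x" and kl: "Suc k \<le> K" "l \<le> L"
  shows "x = {a k, a (Suc k)} \<or> (\<exists>j\<le>l. x = {a (Suc k), b j})"
proof -
  obtain y where y: "x = {a (Suc k), y}" "y \<noteq> a (Suc k)" "y \<in> vs (Suc k) l"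
    using x(2,3) by (elim pairsD) auto
  consider i where "y = a i" "i \<le> k" | j where "y = b j" "j \<le> l"
    using y(2,3) unfolding vs_def by (auto simp: le_Suc_eq)
  then show ?thesis
  proof cases
    case 1
    then have "Suc k = Suc i" using chord_a[of i "Suc k"] x(1) y(1) kl by (simp add: insert_commute)
    then show ?thesis using y(1) 1 by auto
  next
    case 2
    then show ?thesis using y(1) by blast
  qed
qed

text \<open>Without rungs to earlier \<open>b j\<close>, the new vertex \<open>a (Suc k)\<close> is
  joined to the old part only at \<open>a k\<close> and possibly \<open>b l\<close>. Hence
  \<open>{a k, b l}\<close> cuts it off, and a triangle on these three vertices is attached; its
  outgoing basepoint \<open>{a (Suc k), b l}\<close> may be purely virtual.\<close>

lemma triangle_step:
  assumes kl: "Suc k \<le> K" "l \<le> L"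
    and none: "\<And>j. j < l \<Longrightarrow> {a (Suc k), b j} \<notin> E"
    and IH: "0 < k + l \<Longrightarrow> ladder_model (vs k l) (E \<inter> pairs (vs k l) - {{a k, b l}}) {a k, b l} False"
  shows "ladder_model (vs (Suc k) l) (E \<inter> pairs (vs (Suc k) l) - {{a (Suc k), b l}}) {a (Suc k), b l} False"
proof -
  define W where "W = {a k, a (Suc k), b l}"
  have dist: "a k \<noteq> a (Suc k)" "a k \<noteq> b l" "a (Suc k) \<noteq> b l"
    using kl a_eq[of k "Suc k"] a_neq_b[of _ l] by auto
  have card: "card W = 3" using dist by (simp add: W_def)
  have q': "{a (Suc k), b l} \<in> pairs W" using dist by (simp add: W_def pairs_def)
  have W_pairs: "x = {a k, a (Suc k)} \<or> x = {a k, b l} \<or> x = {a (Suc k), b l}" if "x \<in> pairs W" for x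
    using that by (elim pairsD) (auto simp: W_def)
  show ?thesis
  proof (cases "k + l = 0")
    \<comment> \<open>There is no earlier part, and the triangle is the first label. Its side
      \<open>{a 0, b 0}\<close> must be a genuine edge, which \<open>first_rung\<close>
      provides.\<close>
    case True
    then have "vs (Suc k) l = W" unfolding vs_def W_def by (auto simp: atMost_Suc)
    moreover have "pairs W - {{a (Suc k), b l}} \<subseteq> E"
      using W_pairs rail_a[of k] first_rung kl True by auto
    ultimately show ?thesis using ladder_model_start[of W] card q' by simp
  next
    case False
    have vW: "vs (Suc k) l = vs k l \<union> W" unfolding vs_def W_def by (auto simp: atMost_Suc)
    have new: "a (Suc k) \<notin> vs k l"
      using kl a_eq a_neq_b unfolding vs_def by auto
    show ?thesis
      unfolding vW
    proof (rule ladder_model_extend)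
      show "ladder_model (vs k l) (E \<inter> pairs (vs k l) - {{a k, b l}}) {a k, b l} False"
        using IH False by simp
      show "vs k l \<inter> W = {a k, b l}" using new unfolding W_def by (auto simp: vs_def)
      show "pairs W - {{a k, b l}, {a (Suc k), b l}} \<subseteq> E"
        using W_pairs rail_a[of k] kl by auto
      show "{a (Suc k), b l} \<noteq> {a k, b l}" using dist by (auto simp: doubleton_eq_iff)
      show "E \<inter> pairs (vs k l \<union> W) \<subseteq> pairs (vs k l) \<union> pairs W"
      proof
        fix x assume x: "x \<in> E \<inter> pairs (vs k l \<union> W)"
        show "x \<in> pairs (vs k l) \<union> pairs W"
        proof (cases "a (Suc k) \<in> x")
          case True
          then have "x = {a k, a (Suc k)} \<or> (\<exists>j\<le>l. x = {a (Suc k), b j})"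
            using new_a_edge[of x k l] x vW kl by auto
          then have "x \<subseteq> W" using none x unfolding W_def by (auto simp: le_less)
          then show ?thesis using x by (auto simp: pairs_def)
        next
          case False
          then show ?thesis using x by (auto simp: pairs_def W_def vs_def)
        qed
      qed
    qed (use card q' in auto)
  qed
qed

text \<open>Both rails advance at once. The two crossing rungs and the two rail edges are the four
  non-basepoint edges of the \<open>K4\<close>, whose basepoints \<open>{a k, b l}\<close> and
  \<open>{a (Suc k), b (Suc l)}\<close> form a matching. Any other rung from a new vertex back to
  the old part would cross one of the two rungs in a way that \<open>cross\<close> forbids.\<close>

lemma K4_step:
  assumes kl: "Suc k \<le> K" "Suc l \<le> L"
    and rungs: "{a k, b (Suc l)} \<in> E" "{a (Suc k), b l} \<in> E"
    and IH: "0 < k + l \<Longrightarrow> ladder_model (vs k l) (E \<inter> pairs (vs k l) - {{a k, b l}}) {a k, b l} False"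
  shows "ladder_model (vs (Suc k) (Suc l)) (E \<inter> pairs (vs (Suc k) (Suc l)) - {{a (Suc k), b (Suc l)}})
    {a (Suc k), b (Suc l)} False"
proof -
  interpret sw: ladder E b a L K by (rule swap)
  have vs_sw: "sw.vs i j = vs j i" for i j unfolding vs_def sw.vs_def by blast
  define W where "W = {a k, a (Suc k), b l, b (Suc l)}"
  have dist: "a k \<noteq> a (Suc k)" "b l \<noteq> b (Suc l)" 
    "a k \<noteq> b l" "a k \<noteq> b (Suc l)" "a (Suc k) \<noteq> b l" "a (Suc k) \<noteq> b (Suc l)"
    using kl a_eq[of k "Suc k"] b_eq[of l "Suc l"] a_neq_b by auto
  have card: "card W = 4" using dist by (simp add: W_def)
  have q': "{a (Suc k), b (Suc l)} \<in> pairs W" using dist by (simp add: W_def pairs_def)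
  have W_pairs: "x = {a k, a (Suc k)} \<or> x = {b l, b (Suc l)} \<or> x = {a k, b l} \<or> x = {a (Suc k), b (Suc l)}
      \<or> x = {a k, b (Suc l)} \<or> x = {a (Suc k), b l}" if "x \<in> pairs W" for x
  proof -
    obtain c d where "x = {c, d}" "c \<noteq> d" "c \<in> W" "d \<in> W" using \<open>x \<in> pairs W\<close> by (rule pairsD)
    then show ?thesis unfolding W_def by (elim insertE emptyE; simp add: insert_commute)
  qed
  show ?thesis
  proof (cases "k + l = 0")
    case True
    then have "vs (Suc k) (Suc l) = W" unfolding vs_def W_def by (auto simp: atMost_Suc)
    moreover have "pairs W - {{a (Suc k), b (Suc l)}} \<subseteq> E"
      using W_pairs rail_a[of k] rail_b[of l] rungs first_rung kl True by auto
    ultimately show ?thesis using ladder_model_start[of W] card q' by simp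
  next
    case False
    have vW: "vs (Suc k) (Suc l) = vs k l \<union> W" unfolding vs_def W_def by (auto simp: atMost_Suc)
    have new: "a (Suc k) \<notin> vs k l" "b (Suc l) \<notin> vs k l"
      using kl a_eq b_eq a_neq_b a_neq_b[symmetric] unfolding vs_def by auto
    show ?thesis
      unfolding vW
    proof (rule ladder_model_extend)
      show "ladder_model (vs k l) (E \<inter> pairs (vs k l) - {{a k, b l}}) {a k, b l} False"
        using IH False by simp
      show "vs k l \<inter> W = {a k, b l}" using new unfolding W_def by (auto simp: vs_def)
      show "pairs W - {{a k, b l}, {a (Suc k), b (Suc l)}} \<subseteq> E"
        using W_pairs rail_a[of k] rail_b[of l] rungs kl by auto
      show "{a (Suc k), b (Suc l)} \<noteq> {a k, b l}" using dist by (auto simp: doubleton_eq_iff)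
      show "card W = 3 \<or> card W = 4 \<and> {a k, b l} \<inter> {a (Suc k), b (Suc l)} = {}"
        using card dist dist(1-6)[symmetric] by auto
      show "E \<inter> pairs (vs k l \<union> W) \<subseteq> pairs (vs k l) \<union> pairs W"
      proof
        fix x assume x: "x \<in> E \<inter> pairs (vs k l \<union> W)"
        consider "a (Suc k) \<in> x" | "b (Suc l) \<in> x" | "a (Suc k) \<notin> x" "b (Suc l) \<notin> x" by blast
        then show "x \<in> pairs (vs k l) \<union> pairs W"
        proof cases
          case 1
          then consider "x = {a k, a (Suc k)}" | j where "j \<le> Suc l" "x = {a (Suc k), b j}"
            using new_a_edge[of x k "Suc l"] x vW kl by auto
          then have "x \<subseteq> W"
          proof cases
            case 2
            \<comment> \<open>For \<open>j \<le> l\<close> the rung \<open>{a (Suc k), b j}\<close>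
              crosses \<open>{a k, b (Suc l)}\<close>, which forces
              \<open>Suc l = Suc j\<close>.\<close>
            then have "j = Suc l \<or> j = l"
              using cross[of k "Suc k" j "Suc l"] kl rungs x by (cases "j = Suc l") auto
            then show ?thesis using 2 unfolding W_def by auto
          qed (auto simp: W_def)
          then show ?thesis using x by (auto simp: pairs_def)
        next
          case 2
          then consider "x = {b l, b (Suc l)}" | i where "i \<le> Suc k" "x = {b (Suc l), a i}"
            using sw.new_a_edge[of x l "Suc k"] x vW kl by (auto simp: vs_sw)
          then have "x \<subseteq> W"
          proof cases
            case (2 i)
            then have "i = Suc k \<or> i = k"
              using cross[of i "Suc k" l "Suc l"] kl rungs x
              by (cases "i = Suc k") (auto simp: insert_commute)
            then show ?thesis using 2 unfolding W_def by auto
          qed (auto simp: W_def)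
          then show ?thesis using x by (auto simp: pairs_def)
        next
          case 3
          then show ?thesis using x by (auto simp: pairs_def W_def vs_def)
        qed
      qed
    qed (use q' in auto)
  qed
qed

text \<open>Induction on the number of vertices. If the last vertex of one rail has no rung to an
  earlier vertex of the other, it is split off by a triangle. Otherwise there are rungs
  \<open>{a k, b j}\<close> and \<open>{a i, b l}\<close> with \<open>j < l\<close> and
  \<open>i < k\<close>; they cross, so by \<open>cross\<close> they are the diagonals of a
  \<open>K4\<close>.\<close>

lemma ladder_model_vs:
  assumes "k \<le> K" "l \<le> L" "0 < k + l"
  shows "ladder_model (vs k l) (E \<inter> pairs (vs k l) - {{a k, b l}}) {a k, b l} False"
  using assms
proof (induction "k + l" arbitrary: k l rule: less_induct)
  case less
  interpret sw: ladder E b a L K by (rule swap)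
  have vs_sw: "sw.vs i j = vs j i" for i j unfolding vs_def sw.vs_def by blast
  show ?case
  proof (cases "\<exists>k'. k = Suc k' \<and> (\<forall>j<l. {a k, b j} \<notin> E)")
    case True
    then obtain k' where "k = Suc k'" "\<forall>j<l. {a k, b j} \<notin> E" by blast
    then show ?thesis
      using triangle_step[of k' l] less.hyps[of k' l] less.prems by auto
  next
    case A: False
    show ?thesis
    proof (cases "\<exists>l'. l = Suc l' \<and> (\<forall>i<k. {a i, b l} \<notin> E)")
      case True
      then obtain l' where "l = Suc l'" "\<forall>i<k. {a i, b l} \<notin> E" by blast
      then show ?thesis
        using sw.triangle_step[of l' k] less.hyps[of k l'] less.prems
        by (auto simp: vs_sw insert_commute)
    next
      case B: False
      \<comment> \<open>If one of \<open>k\<close>, \<open>l\<close> were zero, the condition on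
        rungs at the last vertex of the other rail would hold vacuously.\<close>
      have "k \<noteq> 0"
        using B less.prems by (cases l) auto
      moreover have "l \<noteq> 0"
        using A less.prems by (cases k) auto
      ultimately obtain k' l' where kl: "k = Suc k'" "l = Suc l'"
        using not0_implies_Suc by blast
      then obtain i j where "j < l" "{a k, b j} \<in> E" "i < k" "{a i, b l} \<in> E"
        using A B by blast
      moreover from this have "k = Suc i \<and> l = Suc j"
        using cross less.prems(1,2) by blast
      ultimately show ?thesis
        using K4_step[of k' l'] less.hyps[of k' l'] less.prems kl by auto
    qed
  qed
qed

end

subsection \<open>Paths in 2-connected graphs\<close>

definition path_between :: "'v set set \<Rightarrow> 'v \<Rightarrow> 'v \<Rightarrow> 'v list \<Rightarrow> bool" where
  "path_between E u v xs \<longleftrightarrow>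
     xs \<noteq> [] \<and> distinct xs \<and> successively (\<lambda>x y. {x, y} \<in> E) xs \<and> hd xs = u \<and> last xs = v"

lemma path_between_rev: "path_between E u v xs \<Longrightarrow> path_between E v u (rev xs)"
  unfolding path_between_def by (simp add: hd_rev last_rev insert_commute)

text \<open>A walk is turned into a path from its far end: a vertex already on the path cuts off the
  initial segment before it, any other vertex is prepended.\<close>

lemma path_between_avoiding:
  assumes "(u, v) \<in> {(x, y). {x, y} \<in> E \<and> w \<notin> {x, y}}\<^sup>*" "v \<noteq> w"
  shows "\<exists>xs. path_between E u v xs \<and> w \<notin> set xs"
  using assms(1)
proof (induction rule: converse_rtrancl_induct)
  case base
  have "path_between E v v [v]" by (simp add: path_between_def)
  then show ?case using assms(2) by (intro exI[of _ "[v]"]) simp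
next
  case (step x y)
  then obtain xs where xs: "path_between E y v xs" "w \<notin> set xs" by blast
  show ?case
  proof (cases "x \<in> set xs")
    case True
    then obtain ys zs where s: "xs = ys @ x # zs" by (meson split_list)
    then have "path_between E x v (x # zs)"
      using xs(1) unfolding path_between_def by (auto simp: successively_append_iff)
    then show ?thesis using xs(2) s by (intro exI[of _ "x # zs"]) simp
  next
    case False
    then have "path_between E x v (x # xs)"
      using xs(1) step(1) unfolding path_between_def by (cases xs) auto
    then show ?thesis using xs(2) step(1) by (intro exI[of _ "x # xs"]) auto
  qed
qed

lemma path_between_first_hit:
  assumes "path_between E w y xs" "y \<in> S"
  obtains ys t where "path_between E w t ys" "set ys \<subseteq> set xs" "set ys \<inter> S = {t}"
proof -
  have "y \<in> set xs" using assms(1) unfolding path_between_def by auto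
  then obtain as t bs where s: "xs = as @ t # bs" "t \<in> S" "\<forall>x\<in>set as. x \<notin> S"
    using split_list_first_prop[of xs "\<lambda>x. x \<in> S"] assms(2) by auto
  have "path_between E w t (as @ [t])"
    using assms(1) s(1) unfolding path_between_def
    by (auto simp: successively_append_iff hd_append)
  moreover have "set (as @ [t]) \<subseteq> set xs" "set (as @ [t]) \<inter> S = {t}" using s by auto
  ultimately show ?thesis by (rule that)
qed

text \<open>A path from \<open>u\<close> to \<open>v\<close> that traverses \<open>f\<close>, split
  at \<open>f\<close>. Closing it by the edge \<open>{u, v}\<close> gives a cycle through both
  edges; \<open>as\<close> and the reversal of \<open>bs\<close> are then the two rails.\<close>

definition path_through :: "'v set set \<Rightarrow> 'v \<Rightarrow> 'v \<Rightarrow> 'v set \<Rightarrow> 'v list \<Rightarrow> 'v list \<Rightarrow> bool" where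
  "path_through E u v f as bs \<longleftrightarrow>
     as \<noteq> [] \<and> bs \<noteq> [] \<and> path_between E u v (as @ bs) \<and> {last as, hd bs} = f"

lemma path_through_rev: "path_through E u v f as bs \<Longrightarrow> path_through E v u f (rev bs) (rev as)"
  using path_between_rev[of E u v "as @ bs"] unfolding path_through_def
  by (auto simp: hd_rev last_rev)

text \<open>Follow the old path to \<open>z\<close>, take the edge to \<open>w\<close>, then
  \<open>ys\<close> to its only vertex \<open>t\<close> on the old path, and continue from there. If
  \<open>w\<close> already lies on the path, then \<open>t = w\<close>.\<close>

lemma path_through_detour:
  assumes xs: "path_between E u v (as @ z # bs)" and zw: "{z, w} \<in> E"
    and ys: "path_between E w t ys" "set ys \<inter> set (as @ z # bs) = {t}" and t: "t \<in> set bs"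
  shows "\<exists>cs. path_through E u v {z, w} (as @ [z]) cs"
proof -
  obtain ds cs where bs: "bs = ds @ t # cs" using t by (meson split_list)
  have tcs: "path_between E u v (as @ z # ds @ t # cs)" using xs bs by simp
  have d: "set ys \<inter> set as = {}" "z \<notin> set ys" "set ys \<inter> set cs = {}"
  proof -
    have "x = t" if "x \<in> set ys" "x \<in> set (as @ z # bs)" for x
      using that ys(2) by blast
    moreover have "t \<notin> set as" "t \<noteq> z" "t \<notin> set cs"
      using tcs unfolding path_between_def by auto
    ultimately show "set ys \<inter> set as = {}" "z \<notin> set ys" "set ys \<inter> set cs = {}"
      unfolding bs by fastforce+
  qed
  have "successively (\<lambda>x y. {x, y} \<in> E) (ys @ cs)"
    using tcs ys(1) unfolding path_between_def by (auto simp: successively_append_iff successively_Cons)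
  moreover have "successively (\<lambda>x y. {x, y} \<in> E) (as @ [z])"
    using tcs unfolding path_between_def by (auto simp: successively_append_iff)
  moreover have "hd (ys @ cs) = w" "last (ys @ cs) = v"
    using tcs ys(1) unfolding path_between_def by (auto split: if_splits)
  ultimately have "path_through E u v {z, w} (as @ [z]) (ys @ cs)"
    using tcs ys(1) d zw unfolding path_through_def path_between_def
    by (auto simp: successively_append_iff successively_Cons hd_append)
  then show ?thesis ..
qed

text \<open>Some end \<open>y\<close> of the path differs from \<open>z\<close>. A path from
  \<open>w\<close> to \<open>y\<close> avoiding \<open>z\<close> first hits \<open>xs\<close> at
  some \<open>t \<noteq> z\<close>; if \<open>t\<close> comes after \<open>z\<close> the detour
  applies, and if before, it applies to the reversed path.\<close>

lemma path_through_if_edge_at_path: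
  assumes xs: "path_between E u v xs" "u \<noteq> v" and z: "z \<in> set xs" and zw: "{z, w} \<in> E" "z \<noteq> w"
    and conn: "\<And>y. y \<in> {u, v} \<Longrightarrow> y \<noteq> z \<Longrightarrow> \<exists>ys. path_between E w y ys \<and> z \<notin> set ys"
  shows "\<exists>cs ds. path_through E u v {z, w} cs ds"
proof -
  obtain y where y: "y \<in> {u, v}" "y \<noteq> z" using xs(2) by blast
  then have yxs: "y \<in> set xs" using xs(1) unfolding path_between_def by auto
  obtain ys where ys: "path_between E w y ys" "z \<notin> set ys" using conn[OF y] by blast
  obtain ps t where ps: "path_between E w t ps" "set ps \<subseteq> set ys" "set ps \<inter> set xs = {t}"
    using path_between_first_hit[OF ys(1) yxs] by metis
  obtain as bs where s: "xs = as @ z # bs" using z by (meson split_list)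
  have "t \<noteq> z" using ps ys(2) by blast
  then consider "t \<in> set bs" | "t \<in> set as" using ps(3) s by auto
  then show ?thesis
  proof cases
    case 1
    then show ?thesis using path_through_detour xs(1) zw(1) ps(1,3) s by metis
  next
    case 2
    have "path_between E v u (rev bs @ z # rev as)" using path_between_rev[OF xs(1)] s by simp
    moreover have "set ps \<inter> set (rev bs @ z # rev as) = {t}" using ps(3) s by auto
    ultimately obtain cs where "path_through E v u {z, w} (rev bs @ [z]) cs"
      using path_through_detour[of E v u "rev bs" z "rev as" w t ps] zw(1) ps(1) 2 by auto
    then show ?thesis using path_through_rev by metis
  qed
qed

text \<open>An edge with an end on some path from \<open>u\<close> to \<open>v\<close> can itself be
  put on such a path. Spreading this along edges from \<open>u\<close> shows that every vertex lies
  on such a path, and then so does \<open>f\<close>.\<close>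

lemma path_through_exists:
  assumes E: "E \<subseteq> pairs V" and finV: "2 < card V"
    and conn: "\<And>x y. x \<in> V \<Longrightarrow> y \<in> V \<Longrightarrow> (x, y) \<in> {(x, y). {x, y} \<in> E}\<^sup>*"
    and conn': "\<And>w x y. w \<in> V \<Longrightarrow> x \<in> V - {w} \<Longrightarrow> y \<in> V - {w} \<Longrightarrow>
      \<exists>xs. path_between E x y xs \<and> w \<notin> set xs"
    and uv: "{u, v} \<in> E" and f: "f \<in> E" "f \<noteq> {u, v}"
  shows "\<exists>as bs. path_through E u v f as bs"
proof -
  have uvV: "u \<in> V" "v \<in> V" "u \<noteq> v"
    using uv E unfolding pairs_def by (auto simp: card_2_iff doubleton_eq_iff)
  have EV: "x \<in> V \<and> y \<in> V \<and> x \<noteq> y" if "{x, y} \<in> E" for x y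
    using that E unfolding pairs_def by (auto simp: card_2_iff doubleton_eq_iff)
  have ext: "\<exists>as bs. path_through E u v {z, w} as bs"
    if "path_between E u v xs" "z \<in> set xs" "{z, w} \<in> E" for xs z w
    using path_through_if_edge_at_path[OF that(1) uvV(3) that(2,3)] conn'[of z w] EV[OF that(3)] uvV by blast
  have all: "\<exists>xs. path_between E u v xs \<and> x \<in> set xs" if "x \<in> V" for x
    using conn[OF uvV(1) that]
  proof (induction rule: rtrancl_induct)
    case base
    have "path_between E u v [u, v]" using uv uvV by (simp add: path_between_def)
    then show ?case by (intro exI[of _ "[u, v]"]) simp
  next
    case (step y z)
    then obtain xs where xs: "path_between E u v xs" "y \<in> set xs" by blast
    moreover have yz: "{y, z} \<in> E" using step by simp
    ultimately obtain as bs where p: "path_through E u v {y, z} as bs" using ext by blast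
    then have "z \<in> {last as, hd bs}" unfolding path_through_def by simp
    moreover have "last as \<in> set as" "hd bs \<in> set bs" using p unfolding path_through_def by auto
    ultimately have "z \<in> set (as @ bs)" by auto
    then show ?case using p unfolding path_through_def by blast
  qed
  have "f \<in> pairs V" using f(1) E by blast
  then obtain c d where cd: "f = {c, d}" "c \<in> V" by (rule pairsD)
  obtain xs where "path_between E u v xs" "c \<in> set xs" using all cd(2) by blast
  then show ?thesis using ext f(1) cd(1) by blast
qed

section \<open>Forbidden chords and crossings when all paths through \<open>f\<close> span\<close>

lemma path_through_commute:
  assumes "\<And>as bs. path_through E u v f as bs \<Longrightarrow> set (as @ bs) = V" "path_through E v u f as bs"
  shows "set (as @ bs) = V"
  using assms(1)[OF path_through_rev[OF assms(2)]] by auto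

text \<open>Taking a chord with \<open>j > Suc i\<close> as a shortcut leaves \<open>f\<close> on
  the path, since \<open>last as\<close> is kept, but skips \<open>as ! Suc i\<close>, although the
  path must span.\<close>

lemma spanning_path_chord:
  assumes ham: "\<And>as bs. path_through E u v f as bs \<Longrightarrow> set (as @ bs) = V"
    and p: "path_through E u v f as bs"
    and ij: "i < j" "j < length as" "{as ! i, as ! j} \<in> E"
  shows "j = Suc i"
proof (rule ccontr)
  assume "j \<noteq> Suc i"
  then have j: "Suc i < j" using ij(1) by simp
  define xs ys where "xs = take (Suc i) as" and "ys = drop j as"
  have dist: "distinct as" and bs: "bs \<noteq> []" and q: "path_between E u v (as @ bs)" "{last as, hd bs} = f"
    using p unfolding path_through_def path_between_def by auto
  have as: "as = xs @ take (j - Suc i) (drop (Suc i) as) @ ys"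
    using j ij(2) unfolding xs_def ys_def
    by (metis append_assoc append_take_drop_id less_imp_le_nat take_add le_add_diff_inverse)
  have ne: "xs \<noteq> []" "ys \<noteq> []" using ij by (auto simp: xs_def ys_def)
  have "last xs = as ! i" "hd ys = as ! j"
    using ij by (simp_all add: xs_def ys_def take_Suc_conv_app_nth hd_drop_conv_nth)
  moreover have "last ys = last as" using as ne by (metis last_append append_is_Nil_conv)
  moreover have "hd xs = hd as" using as ne by (metis hd_append2)
  moreover have "set xs \<subseteq> set as" "set ys \<subseteq> set as" unfolding xs_def ys_def by (auto dest: in_set_takeD in_set_dropD)
  moreover have "distinct xs" "distinct ys" "set xs \<inter> set ys = {}"
    using dist j by (auto simp: xs_def ys_def set_take_disj_set_drop_if_distinct)
  moreover have "successively (\<lambda>x y. {x, y} \<in> E) xs" "successively (\<lambda>x y. {x, y} \<in> E) ys"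
    using q(1) as unfolding path_between_def by (metis successively_append_iff)+
  ultimately have "path_through E u v f (xs @ ys) bs"
    using q ne bs ij(3) as unfolding path_through_def path_between_def
    by (auto simp: successively_append_iff hd_append)
  then have "set (xs @ ys @ bs) = V" using ham by fastforce
  moreover have "as ! Suc i \<in> V" using ham[OF p] j ij(2) by auto
  moreover have "as ! Suc i \<notin> set bs"
    using q(1) j ij(2) unfolding path_between_def by (auto simp: disjoint_iff)
  moreover have "as ! Suc i \<notin> set xs" "as ! Suc i \<notin> set ys"
    using dist j ij(2) by (auto simp: xs_def ys_def in_set_conv_nth nth_eq_iff_index_eq)
  ultimately show False by auto
qed

text \<open>Both lists run towards \<open>f\<close>, \<open>as\<close> from \<open>u\<close> and
  \<open>bs\<close> from \<open>v\<close>. Crossing rungs reroute the path: along \<open>as\<close>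
  to \<open>as ! i\<close>, over to \<open>bs ! j'\<close>, on to \<open>f\<close>, through
  \<open>f\<close>, back along \<open>as\<close> to \<open>as ! i'\<close>, over to
  \<open>bs ! j\<close> and back to \<open>v\<close>. Whatever lies strictly between the rungs is
  skipped, so nothing may lie there.\<close>

lemma spanning_path_cross:
  assumes ham: "\<And>as bs. path_through E u v f as bs \<Longrightarrow> set (as @ bs) = V"
    and p: "path_through E u v f as (rev bs)"
    and i: "i < i'" "i' < length as" and j: "j < j'" "j' < length bs"
    and E: "{as ! i, bs ! j'} \<in> E" "{as ! i', bs ! j} \<in> E"
  shows "i' = Suc i \<and> j' = Suc j"
proof -
  define xs ys where "xs = take (Suc i) as" and "ys = drop i' as"
  define zs ws where "zs = drop j' bs" and "ws = take (Suc j) bs"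
  have dist: "distinct as" "distinct bs" "set as \<inter> set bs = {}" "as \<noteq> []" "bs \<noteq> []"
    and q: "path_between E u v (as @ rev bs)" "{last as, last bs} = f"
    using p unfolding path_through_def path_between_def by (auto simp: hd_rev)
  have ne: "xs \<noteq> []" "ys \<noteq> []" "zs \<noteq> []" "ws \<noteq> []" using i j by (auto simp: xs_def ys_def zs_def ws_def)
  have "last xs = as ! i" "hd ys = as ! i'" "last ws = bs ! j" "hd zs = bs ! j'"
    using i j by (simp_all add: xs_def ys_def zs_def ws_def take_Suc_conv_app_nth hd_drop_conv_nth)
  moreover have "last ys = last as" "last zs = last bs" "hd xs = hd as" "hd ws = hd bs"
    using i j dist by (simp_all add: xs_def ys_def zs_def ws_def)
  moreover have sub: "set xs \<subseteq> set as" "set ys \<subseteq> set as" "set zs \<subseteq> set bs" "set ws \<subseteq> set bs"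
    unfolding xs_def ys_def zs_def ws_def by (auto dest: in_set_takeD in_set_dropD)
  moreover have "distinct xs" "distinct ys" "distinct zs" "distinct ws" "set xs \<inter> set ys = {}" "set ws \<inter> set zs = {}"
    using dist i j by (auto simp: xs_def ys_def zs_def ws_def set_take_disj_set_drop_if_distinct)
  moreover have "successively (\<lambda>x y. {x, y} \<in> E) as" "successively (\<lambda>x y. {x, y} \<in> E) bs"
    using q(1) unfolding path_between_def by (auto simp: successively_append_iff insert_commute)
  then have "successively (\<lambda>x y. {x, y} \<in> E) xs" "successively (\<lambda>x y. {x, y} \<in> E) ys"
    "successively (\<lambda>x y. {x, y} \<in> E) zs" "successively (\<lambda>x y. {x, y} \<in> E) ws"
    unfolding xs_def ys_def zs_def ws_def by (metis append_take_drop_id successively_append_iff)+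
  moreover have "hd as = u" "hd bs = v"
    using q(1) dist unfolding path_between_def by (auto simp: last_rev)
  moreover have f: "{last bs, last as} \<in> E"
    using q(1) dist unfolding path_between_def by (auto simp: successively_append_iff hd_rev insert_commute)
  \<comment> \<open>The split is again at \<open>f\<close>, now traversed from
    \<open>last bs\<close> to \<open>last as\<close>.\<close>
  ultimately have "path_through E u v f (xs @ zs) (rev ys @ rev ws)"
    using q(2) ne dist(3) E unfolding path_through_def path_between_def
    by (auto simp: successively_append_iff hd_rev last_rev insert_commute)
  from ham[OF this] have V: "set xs \<union> set zs \<union> set ys \<union> set ws = V" by auto
  have "set as \<union> set bs = V" using ham[OF p] by auto
  then have eq: "set as = set xs \<union> set ys" "set bs = set zs \<union> set ws"
    using V sub dist(3) by blast+
  have "as ! Suc i \<in> set as" "bs ! Suc j \<in> set bs" using i j by auto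
  then have "as ! Suc i \<in> set xs \<union> set ys" "bs ! Suc j \<in> set zs \<union> set ws"
    unfolding eq .
  then show ?thesis
    using dist(1,2) i j
    by (auto simp: xs_def ys_def zs_def ws_def in_set_conv_nth nth_eq_iff_index_eq)
qed

lemma nth_image_atMost:
  assumes "xs \<noteq> []"
  shows "(!) xs ` {..length xs - 1} = set xs"
proof -
  have "{..length xs - 1} = {..<length xs}" using assms by (cases xs) (auto simp: less_Suc_eq_le)
  then show ?thesis by (auto simp: set_conv_nth)
qed

lemma ladder_if_spanning_paths:
  assumes ham: "\<And>as bs. path_through E u v f as bs \<Longrightarrow> set (as @ bs) = V"
    and p: "path_through E u v f as bs" and uv: "{u, v} \<in> E"
  shows "ladder E ((!) as) ((!) (rev bs)) (length as - 1) (length bs - 1)"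
proof -
  have ne: "as \<noteq> []" "bs \<noteq> []" and q: "path_between E u v (as @ bs)"
    using p unfolding path_through_def by auto
  then have dist: "distinct as" "distinct (rev bs)" "set as \<inter> set bs = {}"
    and succ: "successively (\<lambda>x y. {x, y} \<in> E) as" "successively (\<lambda>x y. {x, y} \<in> E) (rev bs)"
    unfolding path_between_def by (auto simp: successively_append_iff insert_commute)
  have le: "i \<le> length as - 1 \<longleftrightarrow> i < length as" "i \<le> length bs - 1 \<longleftrightarrow> i < length (rev bs)" for i
    using ne by (cases as; cases bs; auto simp: less_Suc_eq_le)+
  note pr = path_through_rev[OF p]
  show ?thesis
  proof
    show "inj_on ((!) as) {..length as - 1}" "inj_on ((!) (rev bs)) {..length bs - 1}"
      using dist le by (auto simp: inj_on_def nth_eq_iff_index_eq)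
    show "(!) as ` {..length as - 1} \<inter> (!) (rev bs) ` {..length bs - 1} = {}"
      using nth_image_atMost[of as] nth_image_atMost[of "rev bs"] ne dist(3) by simp
    show "{as ! i, as ! Suc i} \<in> E" if "i < length as - 1" for i
      using succ(1) that by (simp add: successively_conv_nth)
    show "{rev bs ! i, rev bs ! Suc i} \<in> E" if "i < length bs - 1" for i
      using succ(2) that unfolding successively_conv_nth by simp
    show "{as ! 0, rev bs ! 0} \<in> E"
      using q ne uv unfolding path_between_def by (simp add: hd_conv_nth[symmetric] hd_rev)
    show "j = Suc i" if "i < j" "j \<le> length as - 1" "{as ! i, as ! j} \<in> E" for i j
      using spanning_path_chord[OF ham p that(1)] that le by auto
    \<comment> \<open>The chord argument concerns the part before \<open>f\<close>; read from
      \<open>v\<close> to \<open>u\<close>, that part is \<open>rev bs\<close>.\<close>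
    show "j = Suc i" if "i < j" "j \<le> length bs - 1" "{rev bs ! i, rev bs ! j} \<in> E" for i j
      using spanning_path_chord[OF path_through_commute[OF ham] pr that(1)] that le by auto
    show "i' = Suc i \<and> j' = Suc j"
      if "i < i'" "i' \<le> length as - 1" "j < j'" "j' \<le> length bs - 1"
        "{as ! i, rev bs ! j'} \<in> E" "{as ! i', rev bs ! j} \<in> E" for i i' j j'
    proof -
      have p': "path_through E u v f as (rev (rev bs))" using p by simp
      show ?thesis using spanning_path_cross[OF ham p' that(1) _ that(3)] that le by auto
    qed
  qed
qed

section \<open>Passing between the multigraph and its end-sets\<close>

text \<open>The edge \<open>e\<close> closes the path. Since \<open>ends G\<close> is injective, the
  edge names are recovered from consecutive vertices; \<open>e\<close> has index
  \<open>n - 1\<close> and \<open>f\<close> index \<open>length as - 1\<close>.\<close>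

lemma cycle_if_spanning_path:
  assumes inj: "inj_on (ends G) (edges G)" and V: "ends G ` edges G \<subseteq> pairs (verts G)"
    and p: "path_through (ends G ` edges G) u v (ends G f) as bs"
    and e: "e \<in> edges G" "ends G e = {u, v}" and f: "f \<in> edges G" "f \<noteq> e"
  obtains es where "is_cycle G (as @ bs) es" "e \<in> set es" "f \<in> set es"
proof -
  let ?E = "ends G ` edges G"
  define xs where "xs = as @ bs"
  define n where "n = length xs"
  have ne: "as \<noteq> []" "bs \<noteq> []" and q: "path_between ?E u v xs" "{last as, hd bs} = ends G f"
    using p unfolding path_through_def xs_def by auto
  have dist: "distinct xs" using q(1) unfolding path_between_def by simp
  have fe: "ends G f \<noteq> ends G e" using inj e(1) f by (auto simp: inj_on_def)
  \<comment> \<open>A path on two vertices would be \<open>[u, v]\<close>, and \<open>f\<close>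
    would be parallel to \<open>e\<close>. From three vertices on, cyclically consecutive pairs are
    distinct, as \<open>pr_inj\<close> needs.\<close>
  have n: "3 \<le> n"
  proof (rule ccontr)
    assume "\<not> 3 \<le> n"
    moreover have "length as \<noteq> 0" "length bs \<noteq> 0" using ne by auto
    moreover have "length as + length bs = n" by (simp add: n_def xs_def)
    ultimately have "length as = 1" "length bs = 1" by linarith+
    then obtain x y where "as = [x]" "bs = [y]" by (auto simp: length_Suc_conv)
    then show False using q fe e(2) unfolding path_between_def xs_def by auto
  qed
  define pr where "pr i = {xs ! i, xs ! (Suc i mod n)}" for i
  define es where "es = map (\<lambda>i. inv_into (edges G) (ends G) (pr i)) [0..<n]"
  have step: "pr i \<in> ?E" if "i < n" for i
  proof (cases "Suc i = n")
    case True
    then have "i = n - 1" by simp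
    then have "xs ! i = v" "xs ! 0 = u"
      using q(1) unfolding path_between_def by (auto simp: n_def hd_conv_nth last_conv_nth)
    then show ?thesis using e True by (auto simp: pr_def insert_commute image_iff)
  next
    case False
    then show ?thesis
      using q(1) that unfolding path_between_def by (simp add: n_def pr_def successively_conv_nth)
  qed
  have ends: "ends G (es ! i) = pr i" "es ! i \<in> edges G" if "i < n" for i
    using step[OF that] that by (simp_all add: es_def f_inv_into_f inv_into_into)
  have mod: "Suc i mod n < n" "Suc i mod n = (if Suc i = n then 0 else Suc i)" if "i < n" for i
    using that n by auto
  have pr_inj: "i = j" if "i < n" "j < n" "pr i = pr j" for i j
  proof -
    have "{i, Suc i mod n} = {j, Suc j mod n}"
      using that dist mod(1)[OF that(1)] mod(1)[OF that(2)] unfolding pr_def n_def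
      by (auto simp: doubleton_eq_iff nth_eq_iff_index_eq)
    then show ?thesis
      using n that unfolding mod(2)[OF that(1)] mod(2)[OF that(2)]
      by (auto simp: doubleton_eq_iff split: if_splits)
  qed
  have len: "length es = n" by (simp add: es_def)
  have "distinct es"
    unfolding distinct_conv_nth len using pr_inj ends(1) by metis
  moreover have "set es \<subseteq> edges G" using ends(2) len by (auto simp: in_set_conv_nth)
  moreover have "set xs \<subseteq> verts G"
  proof
    fix x assume "x \<in> set xs"
    then obtain i where "i < n" "x = xs ! i" by (auto simp: in_set_conv_nth n_def)
    then have "x \<in> pr i" "pr i \<in> ?E" using step by (auto simp: pr_def)
    then show "x \<in> verts G" using V by (auto simp: pairs_def)
  qed
  ultimately have "is_cycle G xs es"
    unfolding is_cycle_def using ne dist len ends(1) by (auto simp: n_def pr_def xs_def)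
  moreover have mem: "g \<in> set es" if "i < n" "g \<in> edges G" "pr i = ends G g" for g i
  proof -
    have "es ! i = g" using ends[OF that(1)] that(2,3) inj by (auto simp: inj_on_def)
    then show ?thesis using that(1) len by auto
  qed
  have "e \<in> set es"
  proof (rule mem)
    show "n - 1 < n" using n by simp
    have "xs ! (n - 1) = v" "xs ! 0 = u"
      using q(1) unfolding path_between_def by (auto simp: n_def hd_conv_nth last_conv_nth)
    then show "pr (n - 1) = ends G e" using n e(2) by (auto simp: pr_def)
  qed (rule e(1))
  moreover have "f \<in> set es"
  proof (rule mem)
    show "length as - 1 < n" using ne by (cases as) (auto simp: n_def xs_def)
    have "Suc (length as - 1) mod n = length as" using ne by (simp add: n_def xs_def)
    then show "pr (length as - 1) = ends G f"
      using ne q(2) by (simp add: pr_def xs_def nth_append last_conv_nth hd_conv_nth)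
  qed (rule f(1))
  ultimately show ?thesis using that xs_def by blast
qed

lemma connected_graph_iff:
  "connected_graph G \<longleftrightarrow> verts G \<noteq> {} \<and>
     (\<forall>u\<in>verts G. \<forall>v\<in>verts G. (u, v) \<in> {(x, y). {x, y} \<in> ends G ` edges G}\<^sup>*)"
  unfolding connected_graph_def image_iff by (simp add: eq_commute)

lemma k_connected_2_path_avoiding:
  assumes G: "k_connected 2 G" and w: "w \<in> verts G" "x \<in> verts G - {w}" "y \<in> verts G - {w}"
  shows "\<exists>xs. path_between (ends G ` edges G) x y xs \<and> w \<notin> set xs"
proof (rule path_between_avoiding)
  have "connected_graph (delete_verts G {w})"
    using G w(1) unfolding k_connected_def by simp
  then have "(x, y) \<in> {(x, y). {x, y} \<in> ends G ` {e \<in> edges G. ends G e \<inter> {w} = {}}}\<^sup>*"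
    using w(2,3) unfolding connected_graph_iff by (simp add: delete_verts_def)
  moreover have "{(x, y). {x, y} \<in> ends G ` {e \<in> edges G. ends G e \<inter> {w} = {}}} \<subseteq>
      {(x, y). {x, y} \<in> ends G ` edges G \<and> w \<notin> {x, y}}" by auto
  ultimately show "(x, y) \<in> {(x, y). {x, y} \<in> ends G ` edges G \<and> w \<notin> {x, y}}\<^sup>*"
    using rtrancl_mono by blast
qed (use w in auto)

theorem corollary1p5:
  fixes G :: "('v, 'e) mgraph" and e f :: 'e
  assumes "fin_graph G" and "simple_graph G" and "k_connected 2 G"
    and "e \<in> edges G" and "f \<in> edges G" and "e \<noteq> f"
    and "\<And>vs es. is_cycle G vs es \<Longrightarrow> e \<in> set es \<Longrightarrow> f \<in> set es \<Longrightarrow> hamiltonian_cycle G vs es"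
  shows "clean_ladder G"
proof -
  let ?E = "ends G ` edges G" and ?V = "verts G"
  have inj: "inj_on (ends G) (edges G)"
    using assms(2) by (simp add: simple_graph_def)
  have E: "?E \<subseteq> pairs ?V"
    using assms(1,2) by (auto simp: pairs_def fin_graph_def simple_graph_def)
  have card: "2 < card ?V" using assms(3) by (simp add: k_connected_def)
  have "ends G e \<in> pairs ?V" using E assms(4) by blast
  then obtain u v where uv: "ends G e = {u, v}" by (rule pairsD)
  have fe: "ends G f \<noteq> {u, v}"
    using inj assms(4-6) uv by (auto simp: inj_on_def)
  \<comment> \<open>Closed by \<open>e\<close>, every such path is a cycle through \<open>e\<close>
    and \<open>f\<close>, hence Hamiltonian.\<close>
  have ham: "set (as @ bs) = ?V" if p: "path_through ?E u v (ends G f) as bs" for as bs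
    using cycle_if_spanning_path[OF inj E p assms(4) uv assms(5) assms(6)[symmetric]] assms(7)
    unfolding hamiltonian_cycle_def by metis
  have "connected_graph (delete_verts G {})"
    using assms(3) unfolding k_connected_def by simp
  then have conn: "(x, y) \<in> {(x, y). {x, y} \<in> ?E}\<^sup>*" if "x \<in> ?V" "y \<in> ?V" for x y
    using that unfolding connected_graph_iff by (simp add: delete_verts_def)
  have uvE: "{u, v} \<in> ?E" using uv assms(4) by (metis imageI)
  obtain as bs where p: "path_through ?E u v (ends G f) as bs"
    using path_through_exists[OF E card conn k_connected_2_path_avoiding[OF assms(3)] uvE _ fe]
      assms(5) by blast
  interpret ladder ?E "(!) as" "(!) (rev bs)" "length as - 1" "length bs - 1"
    using ladder_if_spanning_paths[OF ham p uvE] .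
  have ne: "as \<noteq> []" "bs \<noteq> []" and q: "distinct (as @ bs)" "{last as, hd bs} = ends G f"
    using p unfolding path_through_def path_between_def by auto
  have "vs (length as - 1) (length bs - 1) = ?V"
    using nth_image_atMost[of as] nth_image_atMost[of "rev bs"] ne ham[OF p] unfolding vs_def by simp
  moreover have "{as ! (length as - 1), rev bs ! (length bs - 1)} = ends G f"
    using ne q(2) by (simp add: last_conv_nth rev_nth hd_conv_nth)
  moreover have "0 < length as - 1 + (length bs - 1)"
    using card distinct_card[OF q(1)] unfolding ham[OF p] length_append by linarith
  moreover have "?E \<inter> pairs ?V = ?E" using E by blast
  \<comment> \<open>At the far ends of both rails the open basepoint is \<open>f\<close> itself. It
    is left out of the model's edges and returns as the basepoint that is never deleted.\<close>
  ultimately have "ladder_model ?V (?E - {ends G f}) (ends G f) False"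
    using ladder_model_vs[of "length as - 1" "length bs - 1"] by simp
  then show ?thesis
    using clean_ladder_if_ladder_model[of G "?E - {ends G f}" "ends G f"] assms(1,5) inj
    by (simp add: insert_absorb)
qed

end
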